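(* Let $n$ be a positive integer and $x=(x_1,\dots,x_n)$. Then $$P^{\mathrm{B}_n}_{(1^n)}(x;t,0)=\sum_{y\in\mathbb{Z}}(-1)^y t^{\frac32y^2-\frac12y}\bigl(\dot e_{n-3y}(x)+\dot e_{n+1-3y}(x)\bigr),$$ $$P^{\mathrm{B}_n}_{(1^n)}\bigl(x;t,-t^{1/2}\bigr)=\sum_{y\in\mathbb{Z}}t^{y^2-\frac12y}\bigl(\dot e_{n-2y}(x)+\dot e_{n+1-2y}(x)\bigr),$$ $$P^{\mathrm{B}_n}_{(1^n)}(x;t,1)=\frac12\sum_{y\in\mathbb{Z}}(-1)^y t^{y^2}\bigl(\dot e_{n-2y}(x)+\dot e_{n-2y}(x)\bigr)=\sum_{y\in\mathbb{Z}}(-1)^y t^{y^2}\,\dot e_{n-2y}(x).$$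
   Context: $\dot e_r(x)=e_r(x_1,x_1^{-1},\dots,x_n,x_n^{-1})$ is the $r$-th elementary symmetric function in $2n$ variables, equal to $0$ for $r<0$ or $r>2n$. $(1^n)$ is the partition with $n$ parts equal to $1$. For a partition $\lambda$, $l(\lambda)$ is the number of parts and $m_i(\lambda)$ the multiplicity of parts equal to $i$; $(a;t)_m=\prod_{i=0}^{m-1}(1-at^i)$; $v_\lambda(t)=\frac{(t;t)_{n-l(\lambda)}}{(1-t)^{n-l(\lambda)}}\prod_{i\ge1}\frac{(t;t)_{m_i(\lambda)}}{(1-t)^{m_i(\lambda)}}$. Let $W=S_n\ltimes(\mathbb{Z}/2\mathbb{Z})^n$ act on rational functions in $x$ by permuting the $x_i$ and by $x_i\mapsto x_i^{-1}$. For $l(\lambda)\le n$ the $\mathrm{BC}_n$ Hall–Littlewood polynomial is $$P^{\mathrm{BC}_n}_{\lambda}(x;t,s_1,s_2)=\frac{1}{(s_1s_2;t)_{n-l(\lambda)}v_\lambda(t)}\sum_{w\in W}w\Biggl(\prod_{i=1}^n x_i^{-\lambda_i}\frac{(1-s_1x_i)(1-s_2x_i)}{1-x_i^2}\prod_{1\le i<j\le n}\frac{(tx_i-x_j)(1-tx_ix_j)}{(x_i-x_j)(1-x_ix_j)}\Biggr),$$ and the $\mathrm{B}_n$ Hall–Littlewood polynomial is $P^{\mathrm{B}_n}_\lambda(x;t,s)=P^{\mathrm{BC}_n}_\lambda(x;t,s,-1)$. *)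

theory Defs
  imports Complex_Main "HOL-Library.Groups_Big_Fun" "HOL-Combinatorics.Permutations"
begin

text \<open>
  The variables \<open>x\<^sub>1, \<dots>, x\<^sub>n\<close> are the values of \<open>x :: nat \<Rightarrow> 'a\<close> on \<open>{1..n}\<close>, where
  \<open>'a\<close> is an arbitrary field of characteristic 0; taking \<open>'a\<close> to be a field of rational
  functions and the \<open>x\<^sub>i\<close> to be its indeterminates gives the identities of rational functions.
  A rational function in \<open>x\<close> is given by its evaluation \<open>(nat \<Rightarrow> 'a) \<Rightarrow> 'a\<close>, which is
  meaningful wherever no denominator vanishes.
\<close>

definition esym :: "'i set \<Rightarrow> ('i \<Rightarrow> 'a::comm_ring_1) \<Rightarrow> int \<Rightarrow> 'a" where
  "esym I f r = (\<Sum>A | A \<subseteq> I \<and> int (card A) = r. \<Prod>i\<in>A. f i)"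

text \<open>The index \<open>(i, False)\<close> stands for the variable \<open>x\<^sub>i\<close> and \<open>(i, True)\<close> for its inverse.\<close>

definition edot :: "nat \<Rightarrow> (nat \<Rightarrow> 'a::field) \<Rightarrow> int \<Rightarrow> 'a" where
  "edot n x r = esym ({1..n} \<times> UNIV) (\<lambda>(i, b). if b then inverse (x i) else x i) r"

text \<open>In particular, the sums over \<open>y \<in> \<int>\<close> of terms in \<open>edot n x (c - k * y)\<close> with \<open>k \<noteq> 0\<close> have
  finite support, as \<^const>\<open>Sum_any\<close> requires.\<close>

lemma edot_eq_0:
  assumes "r < 0 \<or> r > 2 * int n"
  shows "edot n x r = 0"
proof -
  let ?I = "{1..n} \<times> (UNIV :: bool set)"
  have "int (card A) \<noteq> r" if "A \<subseteq> ?I" for A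
  proof -
    have "card A \<le> card ?I"
      using that by (intro card_mono) auto
    also have "\<dots> = 2 * n"
      by (simp add: card_cartesian_product)
    finally show ?thesis
      using assms by linarith
  qed
  then have "{A. A \<subseteq> ?I \<and> int (card A) = r} = {}"
    by blast
  then show ?thesis
    unfolding edot_def esym_def by (metis (no_types, lifting) sum.empty)
qed

definition qpoch :: "'a::comm_ring_1 \<Rightarrow> 'a \<Rightarrow> nat \<Rightarrow> 'a" where
  "qpoch a t m = (\<Prod>i<m. 1 - a * t ^ i)"

text \<open>
  A partition is the weakly decreasing list of its (positive) parts. Hence \<open>l(lam)\<close> is \<open>length\<close>,
  \<open>m\<^sub>i(lam)\<close> is \<open>count_list\<close>, and \<open>part\<close> pads with zeros beyond the last part.
\<close>

definition part :: "nat list \<Rightarrow> nat \<Rightarrow> nat" where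
  "part lam i = (if 1 \<le> i \<and> i \<le> length lam then lam ! (i - 1) else 0)"

text \<open>The product over \<open>i \<ge> 1\<close> is restricted to the parts that occur; the other factors are 1.\<close>

definition hl_v :: "nat \<Rightarrow> nat list \<Rightarrow> 'a::field \<Rightarrow> 'a" where
  "hl_v n lam t = qpoch t t (n - length lam) / (1 - t) ^ (n - length lam)
     * (\<Prod>i\<in>set lam. qpoch t t (count_list lam i) / (1 - t) ^ count_list lam i)"

text \<open>
  An element of the hyperoctahedral group \<open>W\<close> is a pair of a permutation \<open>\<sigma>\<close> and the set \<open>\<epsilon>\<close>
  of those indices whose variable is inverted; it substitutes \<open>x\<^bsub>\<sigma>(i)\<^esub>\<close> or its inverse for \<open>x\<^sub>i\<close>.
\<close>

definition hyperoct :: "nat \<Rightarrow> ((nat \<Rightarrow> nat) \<times> nat set) set" where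
  "hyperoct n = {\<sigma>. \<sigma> permutes {1..n}} \<times> Pow {1..n}"

definition hyperoct_act ::
  "(nat \<Rightarrow> nat) \<times> nat set \<Rightarrow> ((nat \<Rightarrow> 'a::field) \<Rightarrow> 'a) \<Rightarrow> (nat \<Rightarrow> 'a) \<Rightarrow> 'a" where
  "hyperoct_act = (\<lambda>(\<sigma>, \<epsilon>) f x.
     f (\<lambda>i. if \<sigma> i \<in> \<epsilon> then inverse (x (\<sigma> i)) else x (\<sigma> i)))"

definition hl_summand ::
  "nat \<Rightarrow> nat list \<Rightarrow> 'a::field \<Rightarrow> 'a \<Rightarrow> 'a \<Rightarrow> (nat \<Rightarrow> 'a) \<Rightarrow> 'a" where
  "hl_summand n lam t s1 s2 x =
     (\<Prod>i=1..n. x i powi (- int (part lam i)) * ((1 - s1 * x i) * (1 - s2 * x i) / (1 - (x i)^2)))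
     * (\<Prod>(i, j) | 1 \<le> i \<and> i < j \<and> j \<le> n.
          (t * x i - x j) * (1 - t * x i * x j) / ((x i - x j) * (1 - x i * x j)))"

definition hl_BC ::
  "nat \<Rightarrow> nat list \<Rightarrow> (nat \<Rightarrow> 'a::field) \<Rightarrow> 'a \<Rightarrow> 'a \<Rightarrow> 'a \<Rightarrow> 'a" where
  "hl_BC n lam x t s1 s2 =
     1 / (qpoch (s1 * s2) t (n - length lam) * hl_v n lam t)
     * (\<Sum>w\<in>hyperoct n. hyperoct_act w (hl_summand n lam t s1 s2) x)"

definition hl_B :: "nat \<Rightarrow> nat list \<Rightarrow> (nat \<Rightarrow> 'a::field) \<Rightarrow> 'a \<Rightarrow> 'a \<Rightarrow> 'a" where
  "hl_B n lam x t s = hl_BC n lam x t s (-1)"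

text \<open>
  The conditions on \<open>x\<close> keep the denominators of \<open>hl_summand\<close> and of its images under \<open>W\<close> away
  from 0, the condition on \<open>t\<close> does so for \<open>hl_v\<close> and its inverse. The remaining denominator
  \<open>(s\<^sub>1s\<^sub>2;t)\<close> of \<open>hl_BC\<close> is the empty product when \<open>l(lam) = n\<close>.
\<close>

definition hl_generic :: "nat \<Rightarrow> (nat \<Rightarrow> 'a::field) \<Rightarrow> 'a \<Rightarrow> bool" where
  "hl_generic n x t \<longleftrightarrow>
     (\<forall>i\<in>{1..n}. x i \<noteq> 0 \<and> (x i)^2 \<noteq> 1) \<and>
     (\<forall>i\<in>{1..n}. \<forall>j\<in>{1..n}. i \<noteq> j \<longrightarrow> x i \<noteq> x j \<and> x i * x j \<noteq> 1) \<and>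
     (\<forall>k\<in>{1..n}. t ^ k \<noteq> 1)"

end

theory Submission
  imports Defs "HOL-Computational_Algebra.Polynomial"
begin

text \<open>
  For \<open>\<lambda> = (1\<^sup>n)\<close> the sum over \<open>S\<^sub>n\<close> cancels against \<open>v\<^sub>\<lambda>(t)\<close>, and what remains is the sum \<open>hlsum\<close> over
  the choices of signs \<open>y\<^sub>i = x\<^sub>i\<^bsup>\<plusminus>1\<^esup>\<close> of \<open>\<Prod>\<^sub>i f(y\<^sub>i) \<Prod>\<^bsub>i<j\<^esub> g(y\<^sub>iy\<^sub>j)\<close> with
  \<open>f(z) = (1 - sz) / (z(1 - z))\<close> and \<open>g(z) = (1 - tz) / (1 - z)\<close>. The residues of this sum at
  \<open>x\<^sub>n = 1\<close> and \<open>x\<^sub>n = x\<^sub>i\<^bsup>\<plusminus>1\<^esup>\<close> vanish, so that it is \<open>x\<^sub>n + x\<^sub>n\<^bsup>-1\<^esup>\<close> times the sum for \<open>n - 1\<close> variables,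
  up to a term that does not depend on \<open>x\<^sub>n\<close>. The right-hand sides have the same property: they are
  the constant terms of \<open>z\<^bsup>-n\<^esup> \<Prod>\<^sub>i (1 + zx\<^sub>i)(1 + z/x\<^sub>i) \<Theta>(z)\<close> for theta series \<open>\<Theta>\<close>. By induction on
  \<open>n\<close> the difference of the two sides is constant in \<open>x\<close>, and it suffices to compare them at
  \<open>x = (-1, -t, \<dots>, -t\<^bsup>n-1\<^esup>)\<close>. There only two equal terms of the sign sum survive, and both sides are
  multiplied by \<open>-t\<^bsup>-n\<^esup>(1 + st\<^sup>n)\<close> when \<open>n\<close> becomes \<open>n + 1\<close>; for the theta side this follows from its
  quasi-periodicity under \<open>z \<mapsto> tz\<close>. This covers all \<open>t \<noteq> 0\<close> that are not roots of unity, and the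
  remaining \<open>t\<close> follow because both sides are polynomials in \<open>t\<close> (in \<open>u = t\<^bsup>1/2\<^esup>\<close> in the second case).
\<close>

subsection \<open>Products over pairs and the sum over the symmetric group\<close>

definition pairs :: "nat set \<Rightarrow> (nat \<times> nat) set" where
  "pairs I = {(i, j). i \<in> I \<and> j \<in> I \<and> i < j}"

lemma finite_pairs: "finite I \<Longrightarrow> finite (pairs I)"
  by (rule finite_subset[of _ "I \<times> I"]) (auto simp: pairs_def)

text \<open>The new index \<open>m\<close> may lie anywhere among the old ones, so a new pair is
  \<open>(i, m)\<close> or \<open>(m, i)\<close>; symmetry of \<open>G\<close> makes its position
  irrelevant.\<close>

lemma prod_pairs_insert:
  fixes G :: "nat \<Rightarrow> nat \<Rightarrow> 'a::comm_monoid_mult"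
  assumes "finite I" "m \<notin> I" "\<And>i j. G i j = G j i"
  shows "(\<Prod>(i, j)\<in>pairs (insert m I). G i j) = (\<Prod>(i, j)\<in>pairs I. G i j) * (\<Prod>i\<in>I. G i m)"
proof -
  let ?h = "\<lambda>i. if i < m then (i, m) else (m, i)"
  have eq: "pairs (insert m I) = pairs I \<union> ?h ` I"
  proof (intro set_eqI iffI)
    fix p assume "p \<in> pairs (insert m I)"
    moreover have "(a, m) \<in> ?h ` I" if "a \<in> I" "a < m" for a
      using that by (intro image_eqI[of _ _ a]) auto
    moreover have "(m, a) \<in> ?h ` I" if "a \<in> I" "m < a" for a
      using that by (intro image_eqI[of _ _ a]) auto
    ultimately show "p \<in> pairs I \<union> ?h ` I"
      unfolding pairs_def by blast
  next
    fix p assume "p \<in> pairs I \<union> ?h ` I"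
    then show "p \<in> pairs (insert m I)"
      using assms(2) by (auto simp: pairs_def linorder_not_less less_le split: if_splits)
  qed
  have fin: "finite (pairs I)"
    using assms(1) by (rule finite_pairs)
  have disj: "pairs I \<inter> ?h ` I = {}"
    using assms(2) by (auto simp: pairs_def split: if_splits)
  have inj: "inj_on ?h I"
    by (auto simp: inj_on_def split: if_splits)
  have "(\<Prod>(i, j)\<in>?h ` I. G i j) = (\<Prod>i\<in>I. G i m)"
    unfolding prod.reindex[OF inj] by (rule prod.cong) (auto simp: assms(3))
  then show ?thesis
    unfolding eq prod.union_disjoint[OF fin finite_imageI[OF assms(1)] disj] by (rule arg_cong)
qed

text \<open>The map \<open>h\<close> need not be monotone: it may reverse pairs, which a symmetric
  \<open>G\<close> does not notice. This serves both permutations and relabellings of the index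
  set.\<close>

lemma prod_pairs_image:
  fixes G :: "nat \<Rightarrow> nat \<Rightarrow> 'a::comm_monoid_mult"
  assumes "finite J" "inj_on h J" "\<And>i j. G i j = G j i"
  shows "(\<Prod>(i, j)\<in>pairs (h ` J). G i j) = (\<Prod>(i, j)\<in>pairs J. G (h i) (h j))"
  using assms(1,2)
proof (induction J)
  case empty
  then show ?case by (simp add: pairs_def)
next
  case (insert m J)
  have "h m \<notin> h ` J" and inj: "inj_on h J"
    using insert by auto
  have "(\<Prod>(i, j)\<in>pairs (h ` insert m J). G i j)
      = (\<Prod>(i, j)\<in>pairs (h ` J). G i j) * (\<Prod>i\<in>h ` J. G i (h m))"
    using prod_pairs_insert[of "h ` J" "h m" G] insert.hyps \<open>h m \<notin> h ` J\<close> assms(3) by simp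
  also have "\<dots> = (\<Prod>(i, j)\<in>pairs J. G (h i) (h j)) * (\<Prod>i\<in>J. G (h i) (h m))"
    using insert.IH[OF inj] by (simp add: prod.reindex[OF inj])
  also have "\<dots> = (\<Prod>(i, j)\<in>pairs (insert m J). G (h i) (h j))"
    using prod_pairs_insert[of J m "\<lambda>i j. G (h i) (h j)"] insert.hyps assms(3) by simp
  finally show ?case .
qed

section \<open>Symmetrization over the symmetric group by interpolation\<close>

lemma degree_diff_le_of_lead_coeff_eq:
  fixes p q :: "'a::comm_ring_1 poly"
  assumes "degree p = Suc d" "degree q = Suc d" "lead_coeff p = lead_coeff q"
  shows "degree (p - q) \<le> d"
proof (rule degree_le, intro allI impI)
  fix i assume "d < i"
  then consider "i = Suc d" | "Suc d < i" by linarith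
  then show "coeff (p - q) i = 0"
    using assms by cases (simp_all add: coeff_eq_0)
qed

lemma prod_linear_poly:
  fixes a :: "'i \<Rightarrow> 'a::field"
  assumes "c \<noteq> 0"
  shows "degree (\<Prod>i\<in>I. [:a i, c:]) = card I" "lead_coeff (\<Prod>i\<in>I. [:a i, c:]) = c ^ card I"
proof -
  have "degree (\<Prod>i\<in>I. [:a i, c:]) = (\<Sum>i\<in>I. degree [:a i, c:])"
    using assms by (intro degree_prod_eq_sum_degree) auto
  then show "degree (\<Prod>i\<in>I. [:a i, c:]) = card I"
    using assms by simp
  show "lead_coeff (\<Prod>i\<in>I. [:a i, c:]) = c ^ card I"
    using assms by (simp only: lead_coeff_prod) simp
qed

text \<open>Lagrange interpolation: \<open>p\<close> and \<open>q\<close> have degree below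
  \<open>card I\<close> and agree at all the points \<open>y k\<close>, hence coincide. Comparing
  their values at 0 gives the claim.\<close>

lemma sum_prod_quotient:
  fixes y :: "'i \<Rightarrow> 'a::field"
  assumes "finite I" "inj_on y I" "\<And>i. i \<in> I \<Longrightarrow> y i \<noteq> 0" "t \<noteq> 1"
  shows "(\<Sum>m\<in>I. \<Prod>i\<in>I - {m}. (t * y i - y m) / (y i - y m)) = (1 - t ^ card I) / (1 - t)"
proof (cases "I = {}")
  case False
  then obtain d where d: "card I = Suc d"
    using assms(1) by (metis card_0_eq not0_implies_Suc)
  define c where "c m = (\<Prod>i\<in>I - {m}. (t * y i - y m) / (y i - y m))" for m
  \<comment> \<open>Here \<open>(t - 1) * y m\<close> is the factor with \<open>i = m\<close> in the
    product of the \<open>t * y i - y m\<close>, so that \<open>p\<close> takes at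
    \<open>y m\<close> the value that \<open>q\<close> has there.\<close>
  define p where "p = (\<Sum>m\<in>I. smult (c m * ((t - 1) * y m)) (\<Prod>i\<in>I - {m}. [:y i, -1:]))"
  define q where "q = (\<Prod>i\<in>I. [:t * y i, -1:]) - (\<Prod>i\<in>I. [:y i, -1:])"
  have "degree p \<le> d"
    unfolding p_def
  proof (intro degree_sum_le assms(1) order.trans[OF degree_smult_le])
    fix m assume "m \<in> I"
    then show "degree (\<Prod>i\<in>I - {m}. [:y i, -1:]) \<le> d"
      using prod_linear_poly(1)[of "-1" y "I - {m}"] d assms(1) by simp
  qed
  \<comment> \<open>Both products in \<open>q\<close> have leading coefficient
    \<open>(-1) ^ card I\<close>, so their difference loses one degree.\<close>
  moreover have "degree q \<le> d"
    unfolding q_def using prod_linear_poly[of "-1" "\<lambda>i. t * y i" I] prod_linear_poly[of "-1" y I] d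
    by (intro degree_diff_le_of_lead_coeff_eq) auto
  moreover have "poly p a = poly q a" if a: "a \<in> y ` I" for a
  proof -
    obtain k where k: "k \<in> I" "a = y k"
      using a by blast
    have I: "I = insert k (I - {k})"
      using k by blast
    have "poly p a = (\<Sum>m\<in>I. if m = k then c k * ((t - 1) * y k) * (\<Prod>i\<in>I - {k}. y i - y k) else 0)"
      unfolding p_def poly_sum
    proof (rule sum.cong)
      fix m assume "m \<in> I"
      have "(\<Prod>i\<in>I - {m}. y i - y k) = 0" if "m \<noteq> k"
        using that k assms(1) by (intro prod_zero) auto
      then show "poly (smult (c m * ((t - 1) * y m)) (\<Prod>i\<in>I - {m}. [:y i, -1:])) a
          = (if m = k then c k * ((t - 1) * y k) * (\<Prod>i\<in>I - {k}. y i - y k) else 0)"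
        by (auto simp: poly_prod k)
    qed simp
    also have "\<dots> = (t - 1) * y k * (c k * (\<Prod>i\<in>I - {k}. y i - y k))"
      using k assms(1) by simp
    also have "c k * (\<Prod>i\<in>I - {k}. y i - y k) = (\<Prod>i\<in>I - {k}. t * y i - y k)"
      unfolding c_def prod.distrib[symmetric]
      using assms(2) k by (intro prod.cong) (auto simp: inj_on_def)
    also have "(t - 1) * y k * \<dots> = (\<Prod>i\<in>I. t * y i - y k)"
      by (subst (2) I) (simp add: prod.insert_remove assms(1) left_diff_distrib)
    also have "(\<Prod>i\<in>I. y i - y k) = 0"
      using k assms(1) by (intro prod_zero) auto
    then have "(\<Prod>i\<in>I. t * y i - y k) = poly q a"
      by (simp add: q_def poly_prod k)
    finally show ?thesis .
  qed
  moreover have "card (y ` I) = Suc d"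
    using assms(2) d by (simp add: card_image)
  ultimately have "p = q"
    by (intro poly_eqI_degree[of "y ` I"]) auto
  then have "poly p 0 = poly q 0"
    by simp
  moreover have "poly p 0 = (t - 1) * (\<Prod>i\<in>I. y i) * (\<Sum>m\<in>I. c m)"
    unfolding p_def poly_sum sum_distrib_left
    by (intro sum.cong) (auto simp: poly_prod prod.remove[OF assms(1)])
  moreover have "poly q 0 = (t ^ card I - 1) * (\<Prod>i\<in>I. y i)"
    by (simp add: q_def poly_prod prod.distrib left_diff_distrib)
  moreover have "(\<Prod>i\<in>I. y i) \<noteq> 0"
    using assms by simp
  ultimately have "(t - 1) * (\<Sum>m\<in>I. c m) = t ^ card I - 1"
    by simp
  then show ?thesis
    using assms(4) unfolding c_def by (simp add: field_simps)
qed simp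

text \<open>Sort the permutations by the index \<open>b\<close> whose variable comes last. The pairs
  that involve the last position contribute a product that does not depend on the order of the
  others; the rest is the induction hypothesis, and \<open>sum_prod_quotient\<close> adds up the
  contributions of the \<open>b\<close>.\<close>

lemma sum_permutations_prod_quotient:
  fixes y :: "nat \<Rightarrow> 'a::field"
  assumes "inj_on y {1..n}" "\<And>i. i \<in> {1..n} \<Longrightarrow> y i \<noteq> 0" "t \<noteq> 1"
  shows "(\<Sum>\<sigma> | \<sigma> permutes {1..n}. \<Prod>(i, j)\<in>pairs {1..n}.
      (t * y (\<sigma> i) - y (\<sigma> j)) / (y (\<sigma> i) - y (\<sigma> j))) = qpoch t t n / (1 - t) ^ n"
  using assms(1,2)
proof (induction n arbitrary: y)
  case 0
  then show ?case by (simp add: pairs_def qpoch_def)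
next
  case (Suc n)
  let ?h = "\<lambda>a b. (t * a - b) / (a - b) :: 'a"
  let ?T = "\<lambda>b. Transposition.transpose (Suc n) b"
  have ins: "{1..Suc n} = insert (Suc n) {1..n}" by auto
  have pairs_Suc: "pairs (insert (Suc n) {1..n}) = pairs {1..n} \<union> (\<lambda>i. (i, Suc n)) ` {1..n}"
    by (auto simp: pairs_def)
  have fin: "finite (pairs {1..n})"
    by (simp add: finite_pairs)
  \<comment> \<open>The quotient is not symmetric, so \<open>prod_pairs_insert\<close> does not
    apply; but \<open>Suc n\<close> is the largest index and hence always the second entry of a
    pair.\<close>
  have split: "(\<Prod>(i, j)\<in>pairs (insert (Suc n) {1..n}). G i j)
      = (\<Prod>(i, j)\<in>pairs {1..n}. G i j) * (\<Prod>i\<in>{1..n}. G i (Suc n))" for G :: "nat \<Rightarrow> nat \<Rightarrow> 'a"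
    unfolding pairs_Suc by (subst prod.union_disjoint[OF fin])
      (auto simp: pairs_def prod.reindex inj_on_def)
  have step: "(\<Sum>q | q permutes {1..n}. \<Prod>(i, j)\<in>pairs (insert (Suc n) {1..n}).
      ?h (y ((?T b \<circ> q) i)) (y ((?T b \<circ> q) j)))
      = qpoch t t n / (1 - t) ^ n * (\<Prod>i\<in>insert (Suc n) {1..n} - {b}. ?h (y i) (y b))"
    if b: "b \<in> insert (Suc n) {1..n}" for b
  proof -
    \<comment> \<open>The transposition moves \<open>y b\<close> to the last position and leaves the
      other values on \<open>{1..n}\<close>, where the induction hypothesis applies to them.\<close>
    define z where "z = y \<circ> ?T b"
    have im: "?T b ` {1..n} = insert (Suc n) {1..n} - {b}"
      using b by (auto simp: Transposition.transpose_def image_iff)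
    have inj: "inj_on (?T b) {1..n}"
      by (rule inj_on_subset[of _ UNIV]) auto
    have injz: "inj_on z {1..n}"
      unfolding z_def
      by (intro comp_inj_on inj inj_on_subset[OF Suc.prems(1)]) (use im ins in blast)
    have nz: "z i \<noteq> 0" if "i \<in> {1..n}" for i
    proof -
      have "?T b i \<in> insert (Suc n) {1..n}" using that im by blast
      then show ?thesis unfolding z_def comp_def using Suc.prems(2) ins by blast
    qed
    have zn: "z (Suc n) = y b" by (simp add: z_def)
    have prd: "(\<Prod>i\<in>{1..n}. ?h (z (q i)) (z (q (Suc n)))) = (\<Prod>i\<in>insert (Suc n) {1..n} - {b}. ?h (y i) (y b))"
      if q: "q permutes {1..n}" for q
    proof -
      have "q (Suc n) = Suc n" using permutes_not_in[OF q] by simp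
      then have "(\<Prod>i\<in>{1..n}. ?h (z (q i)) (z (q (Suc n)))) = (\<Prod>i\<in>{1..n}. ?h (z (q i)) (y b))"
        by (simp add: zn)
      also have "\<dots> = (\<Prod>i\<in>{1..n}. ?h (z i) (y b))"
        by (rule prod.permute[OF q, of "\<lambda>i. ?h (z i) (y b)", unfolded comp_def, symmetric])
      also have "\<dots> = (\<Prod>i\<in>?T b ` {1..n}. ?h (y i) (y b))"
        unfolding prod.reindex[OF inj] by (simp add: z_def)
      finally show ?thesis unfolding im .
    qed
    have "(\<Sum>q | q permutes {1..n}. \<Prod>(i, j)\<in>pairs (insert (Suc n) {1..n}).
      ?h (y ((?T b \<circ> q) i)) (y ((?T b \<circ> q) j)))
      = (\<Sum>q | q permutes {1..n}. (\<Prod>(i, j)\<in>pairs {1..n}. ?h (z (q i)) (z (q j)))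
          * (\<Prod>i\<in>insert (Suc n) {1..n} - {b}. ?h (y i) (y b)))"
    proof (rule sum.cong)
      fix q assume "q \<in> {q. q permutes {1..n}}"
      then show "(\<Prod>(i, j)\<in>pairs (insert (Suc n) {1..n}). ?h (y ((?T b \<circ> q) i)) (y ((?T b \<circ> q) j)))
        = (\<Prod>(i, j)\<in>pairs {1..n}. ?h (z (q i)) (z (q j)))
          * (\<Prod>i\<in>insert (Suc n) {1..n} - {b}. ?h (y i) (y b))"
        using prd[of q] unfolding split by (simp add: z_def)
    qed simp
    then show ?thesis
      using Suc.IH[OF injz nz] by (simp add: sum_distrib_right[symmetric])
  qed
  have "(\<Sum>\<sigma> | \<sigma> permutes {1..Suc n}. \<Prod>(i, j)\<in>pairs {1..Suc n}. ?h (y (\<sigma> i)) (y (\<sigma> j)))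
    = (\<Sum>b\<in>insert (Suc n) {1..n}. \<Sum>q | q permutes {1..n}. \<Prod>(i, j)\<in>pairs (insert (Suc n) {1..n}).
      ?h (y ((?T b \<circ> q) i)) (y ((?T b \<circ> q) j)))"
    unfolding ins by (rule sum_over_permutations_insert) auto
  also have "\<dots> = qpoch t t n / (1 - t) ^ n *
      (\<Sum>b\<in>insert (Suc n) {1..n}. \<Prod>i\<in>insert (Suc n) {1..n} - {b}. ?h (y i) (y b))"
    unfolding sum_distrib_left by (rule sum.cong[OF refl step])
  also have "(\<Sum>b\<in>insert (Suc n) {1..n}. \<Prod>i\<in>insert (Suc n) {1..n} - {b}. ?h (y i) (y b))
      = (1 - t ^ Suc n) / (1 - t)"
    using sum_prod_quotient[OF _ Suc.prems assms(3)] unfolding ins by simp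
  finally show ?case
    by (simp add: qpoch_def)
qed

subsection \<open>The sum over signs\<close>

lemma sum_Pow_insert:
  assumes "finite I" "m \<notin> I"
  shows "(\<Sum>E\<in>Pow (insert m I). h E) = (\<Sum>E\<in>Pow I. h E + h (insert m E))"
proof -
  have "inj_on (insert m) (Pow I)"
    using assms(2) by (auto simp: inj_on_def)
  moreover have "Pow I \<inter> insert m ` Pow I = {}"
    using assms(2) by auto
  ultimately show ?thesis
    using assms(1) by (simp add: Pow_insert sum.union_disjoint sum.reindex sum.distrib)
qed

definition flip :: "nat set \<Rightarrow> (nat \<Rightarrow> 'a::field) \<Rightarrow> nat \<Rightarrow> 'a" where
  "flip E x i = (if i \<in> E then inverse (x i) else x i)"

text \<open>The one-variable factor of \<open>hl_summand\<close> for a part 1 and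
  \<open>s2 = -1\<close>, after \<open>1 + z\<close> has been cancelled against
  \<open>1 - z^2\<close>.\<close>

definition hl_single :: "'a::field \<Rightarrow> 'a \<Rightarrow> 'a" where
  "hl_single s z = (1 - s * z) / (z * (1 - z))"

definition hl_pair :: "'a::field \<Rightarrow> 'a \<Rightarrow> 'a" where
  "hl_pair t z = (1 - t * z) / (1 - z)"

definition hlterm :: "'a::field \<Rightarrow> 'a \<Rightarrow> nat set \<Rightarrow> (nat \<Rightarrow> 'a) \<Rightarrow> 'a" where
  "hlterm t s I y = (\<Prod>i\<in>I. hl_single s (y i)) * (\<Prod>(i, j)\<in>pairs I. hl_pair t (y i * y j))"

definition hlsum :: "'a::field \<Rightarrow> 'a \<Rightarrow> nat set \<Rightarrow> (nat \<Rightarrow> 'a) \<Rightarrow> 'a" where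
  "hlsum t s I x = (\<Sum>E\<in>Pow I. hlterm t s I (flip E x))"

lemma hlterm_insert:
  assumes "finite I" "m \<notin> I"
  shows "hlterm t s (insert m I) y = hlterm t s I y * (hl_single s (y m) * (\<Prod>i\<in>I. hl_pair t (y i * y m)))"
  unfolding hlterm_def using assms
  by (subst prod_pairs_insert) (auto simp: mult_ac)

lemma hlterm_cong:
  assumes "\<And>i. i \<in> I \<Longrightarrow> y i = z i"
  shows "hlterm t s I y = hlterm t s I z"
  unfolding hlterm_def using assms
  by (intro arg_cong2[of _ _ _ _ "(*)"] prod.cong) (auto simp: pairs_def)

lemma hlsum_cong:
  assumes "\<And>i. i \<in> I \<Longrightarrow> x i = z i"
  shows "hlsum t s I x = hlsum t s I z"
  unfolding hlsum_def using assms
  by (intro sum.cong hlterm_cong) (auto simp: flip_def)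

lemma hlterm_image:
  assumes "finite J" "inj_on h J"
  shows "hlterm t s (h ` J) y = hlterm t s J (y \<circ> h)"
  unfolding hlterm_def using assms
  by (simp add: prod.reindex prod_pairs_image[OF assms, of "\<lambda>i j. hl_pair t (y i * y j)"] mult.commute)

text \<open>Relabelling lets an induction over the sets \<open>{..<n}\<close> serve arbitrary finite
  index sets, such as those with one index removed.\<close>

lemma hlsum_image:
  assumes "finite J" "inj_on h J"
  shows "hlsum t s (h ` J) x = hlsum t s J (x \<circ> h)"
proof -
  have "inj_on (image h) (Pow J)"
    using assms(2) by (rule inj_on_image_Pow)
  moreover have "Pow (h ` J) = image h ` Pow J"
    by (simp add: image_Pow_surj)
  moreover have "hlterm t s (h ` J) (flip (h ` E) x) = hlterm t s J (flip E (x \<circ> h))" if "E \<subseteq> J" for E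
    unfolding hlterm_image[OF assms]
    by (rule hlterm_cong) (use assms(2) that in \<open>auto simp: flip_def inj_on_def\<close>)
  ultimately show ?thesis
    unfolding hlsum_def by (simp add: sum.reindex)
qed

text \<open>Separating the sign of \<open>m\<close> from the other signs isolates the dependence on
  \<open>x m\<close>.\<close>

lemma hlsum_insert:
  assumes "finite I" "m \<notin> I"
  shows "hlsum t s (insert m I) x = (\<Sum>E\<in>Pow I. hlterm t s I (flip E x) *
    (hl_single s (x m) * (\<Prod>i\<in>I. hl_pair t (flip E x i * x m)) +
     hl_single s (inverse (x m)) * (\<Prod>i\<in>I. hl_pair t (flip E x i * inverse (x m)))))"
proof -
  have "hlterm t s (insert m I) (flip E x) + hlterm t s (insert m I) (flip (insert m E) x)
    = hlterm t s I (flip E x) *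
    (hl_single s (x m) * (\<Prod>i\<in>I. hl_pair t (flip E x i * x m)) +
     hl_single s (inverse (x m)) * (\<Prod>i\<in>I. hl_pair t (flip E x i * inverse (x m))))" if "E \<in> Pow I" for E
  proof -
    have eq: "flip (insert m E) x i = flip E x i" if "i \<in> I" for i
      using that assms(2) by (auto simp: flip_def)
    have m: "flip E x m = x m" "flip (insert m E) x m = inverse (x m)"
      using that assms(2) by (auto simp: flip_def)
    have "hlterm t s I (flip (insert m E) x) = hlterm t s I (flip E x)"
      by (rule hlterm_cong) (rule eq)
    moreover have "(\<Prod>i\<in>I. hl_pair t (flip (insert m E) x i * inverse (x m)))
        = (\<Prod>i\<in>I. hl_pair t (flip E x i * inverse (x m)))"
      by (rule prod.cong) (auto simp: eq)
    ultimately show ?thesis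
      unfolding hlterm_insert[OF assms] m by (simp add: algebra_simps)
  qed
  then show ?thesis
    unfolding hlsum_def sum_Pow_insert[OF assms] by (rule sum.cong[OF refl])
qed

text \<open>The part of \<^const>\<open>hlsum\<close> with signs fixed on \<open>I\<close>, as a function of one further variable,
  cleared of denominators and with the poles at 0 and \<open>\<infinity>\<close> removed.\<close>

definition hlnum :: "'a::field \<Rightarrow> 'a \<Rightarrow> nat set \<Rightarrow> (nat \<Rightarrow> 'a) \<Rightarrow> 'a poly" where
  "hlnum t s I y =
     [:1, -s:] * ((\<Prod>i\<in>I. [:- inverse (y i), t:]) * (\<Prod>i\<in>I. [:- y i, 1:]))
     - ([:0, 0, 1:] * [:-s, 1:] * ((\<Prod>i\<in>I. [:- t * y i, 1:]) * (\<Prod>i\<in>I. [:- inverse (y i), 1:]))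
        - [:1, 0, 1:] * [:-1, 1:] * ((\<Prod>i\<in>I. [:- y i, 1:]) * (\<Prod>i\<in>I. [:- inverse (y i), 1:])))"

lemma hlnum_cong:
  assumes "\<And>i. i \<in> I \<Longrightarrow> y i = z i"
  shows "hlnum t s I y = hlnum t s I z"
proof -
  have *: "(\<Prod>i\<in>I. h (y i)) = (\<Prod>i\<in>I. h (z i))" for h :: "'a \<Rightarrow> 'a poly"
    by (rule prod.cong) (auto simp: assms)
  show ?thesis
    unfolding hlnum_def *[of "\<lambda>u. [:- inverse u, t:]"] *[of "\<lambda>u. [:- u, 1:]"]
      *[of "\<lambda>u. [:- t * u, 1:]"] *[of "\<lambda>u. [:- inverse u, 1:]"] ..
qed

text \<open>The last two of the three summands have degree \<open>2 * card I + 3\<close> and the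
  same leading coefficient. The loss of one degree in their difference is the removal of the pole at
  infinity.\<close>

lemma degree_hlnum: "degree (hlnum t s I y) \<le> 2 * card I + 2"
proof -
  let ?p = "[:0, 0, 1:] * [:-s, 1:] * ((\<Prod>i\<in>I. [:- t * y i, 1:]) * (\<Prod>i\<in>I. [:- inverse (y i), 1:]))"
  let ?q = "[:1, 0, 1:] * [:-1, 1:] * ((\<Prod>i\<in>I. [:- y i, 1:]) * (\<Prod>i\<in>I. [:- inverse (y i), 1:]))"
  have nz: "(\<Prod>i\<in>I. [:a i, 1:]) \<noteq> 0" for a :: "nat \<Rightarrow> 'a"
    by (cases "finite I") auto
  have deg: "degree ([:c0, 0, 1:] * [:c1, 1:] * ((\<Prod>i\<in>I. [:a i, 1:]) * (\<Prod>i\<in>I. [:b i, 1:]))) = Suc (2 * card I + 2)"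
    for c0 c1 and a b :: "nat \<Rightarrow> 'a"
    using nz by (subst degree_mult_eq; simp add: degree_mult_eq prod_linear_poly del: mult_pCons_left)
  have lead: "lead_coeff ([:c0, 0, 1:] * [:c1, 1:] * ((\<Prod>i\<in>I. [:a i, 1:]) * (\<Prod>i\<in>I. [:b i, 1:]))) = 1"
    for c0 c1 and a b :: "nat \<Rightarrow> 'a"
    by (simp only: lead_coeff_mult prod_linear_poly(2)[OF one_neq_zero]) simp
  have "degree (?p - ?q) \<le> 2 * card I + 2"
    by (rule degree_diff_le_of_lead_coeff_eq[OF deg deg]) (simp only: lead)
  \<comment> \<open>Only a bound is available here, since the slope \<open>b\<close> is later
    \<open>t\<close>, which may be 0.\<close>
  moreover have "degree (\<Prod>i\<in>I. [:a i, b:]) \<le> card I" for a :: "nat \<Rightarrow> 'a" and b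
  proof (cases "b = 0")
    case True
    then have "(\<Prod>i\<in>I. [:a i, b:]) = [:\<Prod>i\<in>I. a i:]"
      by (induction I rule: infinite_finite_induct) auto
    then show ?thesis by simp
  qed (simp add: prod_linear_poly)
  then have "degree ([:1, -s:] * ((\<Prod>i\<in>I. [:- inverse (y i), t:]) * (\<Prod>i\<in>I. [:- y i, 1:])))
      \<le> 1 + (card I + card I)"
    by (intro order.trans[OF degree_mult_le] add_mono) auto
  then have "degree ([:1, -s:] * ((\<Prod>i\<in>I. [:- inverse (y i), t:]) * (\<Prod>i\<in>I. [:- y i, 1:])))
      \<le> 2 * card I + 2"
    by linarith
  ultimately show ?thesis
    unfolding hlnum_def by (rule degree_diff_le[rotated])
qed

lemma poly_hlnum:
  "poly (hlnum t s I y) z =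
     (1 - s * z) * ((\<Prod>i\<in>I. t * z - inverse (y i)) * (\<Prod>i\<in>I. z - y i))
     - z\<^sup>2 * (z - s) * ((\<Prod>i\<in>I. z - t * y i) * (\<Prod>i\<in>I. z - inverse (y i)))
     + (z\<^sup>2 + 1) * (z - 1) * ((\<Prod>i\<in>I. z - y i) * (\<Prod>i\<in>I. z - inverse (y i)))"
  by (simp add: hlnum_def poly_prod algebra_simps power2_eq_square)

text \<open>The first and the last summand have the values 1 and -1 at 0, which is the removal of
  the pole there.\<close>

lemma poly_hlnum_0:
  assumes "finite I" "\<And>i. i \<in> I \<Longrightarrow> y i \<noteq> 0"
  shows "poly (hlnum t s I y) 0 = 0"
  using assms unfolding poly_hlnum
  by (simp add: prod.distrib[symmetric])

text \<open>The point 1 is fixed under inversion, so the terms for \<open>x m\<close> and for its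
  inverse have opposite residues there, factor by factor.\<close>

lemma poly_hlnum_1:
  assumes "\<And>i. i \<in> I \<Longrightarrow> y i \<noteq> 0"
  shows "poly (hlnum t s I y) 1 = 0"
proof -
  have "(\<Prod>i\<in>I. (t - inverse (y i)) * (1 - y i)) = (\<Prod>i\<in>I. (1 - t * y i) * (1 - inverse (y i)))"
    using assms by (intro prod.cong) (auto simp: field_simps)
  then show ?thesis
    unfolding poly_hlnum by (simp add: prod.distrib)
qed

text \<open>The two terms that differ in the sign of \<open>j\<close> both have a pole at \<open>x j\<close>; the residues cancel.\<close>

lemma poly_hlnum_cancel:
  assumes "finite J" "j \<notin> J" "y j = a" "y' j = inverse a" "\<And>i. i \<in> J \<Longrightarrow> y' i = y i"
    "a \<noteq> 0" "a \<noteq> 1" "\<And>i. i \<in> J \<Longrightarrow> y i \<noteq> 0 \<and> y i \<noteq> a \<and> y i * a \<noteq> 1"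
  shows "hlterm t s (insert j J) y * poly (hlnum t s (insert j J) y) a
    + hlterm t s (insert j J) y' * poly (hlnum t s (insert j J) y') a = 0"
proof -
  have y': "hlterm t s J y' = hlterm t s J y"
    by (rule hlterm_cong) (rule assms)
  have prods: "(\<Prod>i\<in>J. h (y' i)) = (\<Prod>i\<in>J. h (y i))" for h :: "'a \<Rightarrow> 'a"
    by (rule prod.cong) (auto simp: assms(5))
  \<comment> \<open>Both signs of \<open>j\<close> leave this product over \<open>J\<close>, so that
    in the end only the factors belonging to \<open>j\<close> have to be compared.\<close>
  define P where "P = (\<Prod>i\<in>J. t * a - inverse (y i)) * (\<Prod>i\<in>J. a - t * y i)"
  have 1: "(\<Prod>i\<in>J. hl_pair t (y i * a)) * ((\<Prod>i\<in>J. a - t * y i) * (\<Prod>i\<in>J. a - inverse (y i))) = P"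
    unfolding P_def prod.distrib[symmetric]
    by (rule prod.cong) (use assms(6-8) in \<open>auto simp: hl_pair_def field_simps\<close>)
  have 2: "(\<Prod>i\<in>J. hl_pair t (y i * inverse a)) * ((\<Prod>i\<in>J. t * a - inverse (y i)) * (\<Prod>i\<in>J. a - y i)) = P"
    unfolding P_def prod.distrib[symmetric]
  proof (rule prod.cong[OF refl])
    fix i assume "i \<in> J"
    then have "hl_pair t (y i * inverse a) * (a - y i) = a - t * y i"
      using assms(6) assms(8)[of i] by (auto simp: hl_pair_def divide_simps)
    then show "hl_pair t (y i * inverse a) * ((t * a - inverse (y i)) * (a - y i))
        = (t * a - inverse (y i)) * (a - t * y i)"
      by (metis mult.left_commute)
  qed
  \<comment> \<open>At \<open>a\<close> the summands of \<open>poly_hlnum\<close> with the factor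
    \<open>a - y j\<close> vanish, which leaves the middle one; for \<open>y'\<close> the factor
    \<open>a - inverse (y' j)\<close> vanishes, which leaves the first one.\<close>
  have "hlterm t s (insert j J) y * poly (hlnum t s (insert j J) y) a
    = - hlterm t s J y * (hl_single s a * (a\<^sup>2 * (a - s) * (a - t * a) * (a - inverse a))
      * ((\<Prod>i\<in>J. hl_pair t (y i * a)) * ((\<Prod>i\<in>J. a - t * y i) * (\<Prod>i\<in>J. a - inverse (y i)))))"
    unfolding hlterm_insert[OF assms(1,2)] poly_hlnum
    using assms(1,2,3) by (simp add: mult_ac)
  also have "\<dots> = - hlterm t s J y * (hl_single s a * (a\<^sup>2 * (a - s) * (a - t * a) * (a - inverse a)) * P)"
    unfolding 1 ..
  finally have A: "hlterm t s (insert j J) y * poly (hlnum t s (insert j J) y) a = \<dots>" .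
  have "hlterm t s (insert j J) y' * poly (hlnum t s (insert j J) y') a
    = hlterm t s J y * (hl_single s (inverse a) * ((1 - s * a) * (t * a - a) * (a - inverse a))
      * ((\<Prod>i\<in>J. hl_pair t (y i * inverse a)) * ((\<Prod>i\<in>J. t * a - inverse (y i)) * (\<Prod>i\<in>J. a - y i))))"
    unfolding hlterm_insert[OF assms(1,2)] poly_hlnum prod.insert[OF assms(1,2)] assms(4) y'
      prods[of "\<lambda>u. hl_pair t (u * inverse a)"] prods[of "\<lambda>u. t * a - inverse u"] prods[of "\<lambda>u. a - u"]
    by (simp add: mult_ac)
  also have "\<dots> = hlterm t s J y * (hl_single s (inverse a) * ((1 - s * a) * (t * a - a) * (a - inverse a)) * P)"
    unfolding 2 ..
  finally have B: "hlterm t s (insert j J) y' * poly (hlnum t s (insert j J) y') a = \<dots>" .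
  have "hl_single s (inverse a) * ((1 - s * a) * (t * a - a) * (a - inverse a))
    = hl_single s a * (a\<^sup>2 * (a - s) * (a - t * a) * (a - inverse a))"
    using assms(6,7) by (simp add: hl_single_def divide_simps) (simp add: algebra_simps power2_eq_square)
  then show ?thesis
    unfolding A B by simp
qed

text \<open>The value \<open>x i = - 1\<close> is not a pole, but there the distinct poles \<open>x i\<close> and \<open>inverse (x i)\<close> of the
  other variables coincide.\<close>

definition hl_regular :: "nat set \<Rightarrow> (nat \<Rightarrow> 'a::field) \<Rightarrow> bool" where
  "hl_regular I x \<longleftrightarrow> (\<forall>i\<in>I. x i \<noteq> 0 \<and> x i \<noteq> 1)
     \<and> (\<forall>i\<in>I. \<forall>j\<in>I. i \<noteq> j \<longrightarrow> x i \<noteq> x j \<and> x i * x j \<noteq> 1)"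

definition hl_regular_strict :: "nat set \<Rightarrow> (nat \<Rightarrow> 'a::field) \<Rightarrow> bool" where
  "hl_regular_strict I x \<longleftrightarrow> hl_regular I x \<and> (\<forall>i\<in>I. x i \<noteq> -1)"

text \<open>At 0 and 1 each summand vanishes by itself; at \<open>x j\<close> and its inverse the
  sign choices cancel in pairs that differ in the sign of \<open>j\<close> only.\<close>

lemma sum_poly_hlnum_eq_0:
  assumes I: "finite I" and gen: "hl_regular I x" and z: "z \<in> {0, 1} \<union> x ` I \<union> inverse ` x ` I"
  shows "(\<Sum>E\<in>Pow I. hlterm t s I (flip E x) * poly (hlnum t s I (flip E x)) z) = 0"
proof -
  have nz: "flip E x i \<noteq> 0" if "i \<in> I" for E i
    using gen that by (auto simp: flip_def hl_regular_def)
  consider "z = 0" | "z = 1" | j where "j \<in> I" "z = x j \<or> z = inverse (x j)"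
    using z by auto
  then show ?thesis
  proof cases
    case 1
    then show ?thesis by (simp add: poly_hlnum_0[OF I nz])
  next
    case 2
    then show ?thesis by (simp add: poly_hlnum_1[OF nz])
  next
    case 3
    define J where "J = I - {j}"
    have I': "I = insert j J" "j \<notin> J" "finite J"
      using 3 I by (auto simp: J_def)
    have xj: "x j \<noteq> 0" "x j \<noteq> 1"
      using gen 3 by (auto simp: hl_regular_def)
    have "hlterm t s I (flip E x) * poly (hlnum t s I (flip E x)) z
      + hlterm t s I (flip (insert j E) x) * poly (hlnum t s I (flip (insert j E) x)) z = 0"
      if "E \<in> Pow J" for E
    proof -
      have fl: "flip E x j = x j" "flip (insert j E) x j = inverse (x j)"
        "\<And>i. i \<in> J \<Longrightarrow> flip (insert j E) x i = flip E x i"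
        using that I'(2) by (auto simp: flip_def)
      have sep: "flip E x i \<noteq> 0 \<and> flip E x i \<noteq> x j \<and> flip E x i * x j \<noteq> 1"
        "flip E x i \<noteq> inverse (x j) \<and> flip E x i * inverse (x j) \<noteq> 1" if "i \<in> J" for i
      proof -
        have "x i \<noteq> 0" "x i \<noteq> x j" "x i * x j \<noteq> 1"
          using gen that I' by (auto simp: hl_regular_def)
        then show "flip E x i \<noteq> 0 \<and> flip E x i \<noteq> x j \<and> flip E x i * x j \<noteq> 1"
          "flip E x i \<noteq> inverse (x j) \<and> flip E x i * inverse (x j) \<noteq> 1"
          using xj by (auto simp: flip_def field_simps)
      qed
      show ?thesis
      proof (cases "z = x j")
        case True
        show ?thesis
          unfolding True I'(1)
          by (rule poly_hlnum_cancel[OF I'(3,2)]) (use fl xj sep in auto)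
      next
        case False
        then have z: "z = inverse (x j)"
          using 3 by simp
        show ?thesis
          unfolding z I'(1)
          by (subst add.commute, rule poly_hlnum_cancel[OF I'(3,2)]) (use fl xj sep in auto)
      qed
    qed
    then show ?thesis
      unfolding I'(1) sum_Pow_insert[OF I'(3,2)] by (intro sum.neutral) auto
  qed
qed

text \<open>The factor on the left is a common denominator in \<open>x m\<close> of all sign
  choices, and \<open>hlnum\<close> is the numerator that each of them leaves.\<close>

lemma hlsum_insert_eq_hlnum:
  assumes I: "finite I" "m \<notin> I" and gen: "hl_regular (insert m I) x"
  shows "(hlsum t s (insert m I) x - (x m + inverse (x m)) * hlsum t s I x)
      * (x m * (1 - x m) * (\<Prod>i\<in>I. (x m - x i) * (x m - inverse (x i))))
    = (\<Sum>E\<in>Pow I. hlterm t s I (flip E x) * poly (hlnum t s I (flip E x)) (x m))"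
    (is "_ * (_ * ?D) = _")
proof -
  define z where "z = x m"
  have z: "z \<noteq> 0" "z \<noteq> 1"
    using gen by (auto simp: hl_regular_def z_def)
  have "(hl_single s z * (\<Prod>i\<in>I. hl_pair t (y i * z)) + hl_single s (inverse z) * (\<Prod>i\<in>I. hl_pair t (y i * inverse z))
      - (z + inverse z)) * (z * (1 - z) * ?D) = poly (hlnum t s I y) z"
    if y: "y = flip E x" for y E
  proof -
    have yz: "y i \<noteq> 0" "y i \<noteq> z" "y i * z \<noteq> 1" if "i \<in> I" for i
    proof -
      have "x i \<noteq> 0" "x i \<noteq> z" "x i * z \<noteq> 1"
        using gen that I unfolding hl_regular_def z_def by (metis insertCI)+
      then show "y i \<noteq> 0" "y i \<noteq> z" "y i * z \<noteq> 1"
        using z by (auto simp: flip_def y field_simps)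
    qed
    \<comment> \<open>Inverting \<open>x i\<close> merely swaps the two factors of index
      \<open>i\<close>, so the denominator is the same for every sign choice.\<close>
    have D: "?D = (\<Prod>i\<in>I. z - y i) * (\<Prod>i\<in>I. z - inverse (y i))"
      unfolding prod.distrib[symmetric] z_def y by (rule prod.cong) (auto simp: flip_def)
    have 1: "(\<Prod>i\<in>I. hl_pair t (y i * z)) * (\<Prod>i\<in>I. z - inverse (y i)) = (\<Prod>i\<in>I. t * z - inverse (y i))"
      unfolding prod.distrib[symmetric]
      by (rule prod.cong) (use z yz in \<open>auto simp: hl_pair_def field_simps\<close>)
    have 2: "(\<Prod>i\<in>I. hl_pair t (y i * inverse z)) * (\<Prod>i\<in>I. z - y i) = (\<Prod>i\<in>I. z - t * y i)"
      unfolding prod.distrib[symmetric]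
      by (rule prod.cong) (use z yz in \<open>auto simp: hl_pair_def divide_simps\<close>)
    have 3: "hl_single s z * (z * (1 - z)) = 1 - s * z"
      using z by (simp add: hl_single_def)
    have 4: "hl_single s (inverse z) * (z * (1 - z)) = - (z\<^sup>2 * (z - s))"
      using z by (simp add: hl_single_def divide_simps) (simp add: algebra_simps power2_eq_square)
    have 5: "(z + inverse z) * (z * (1 - z)) = - ((z\<^sup>2 + 1) * (z - 1))"
      using z by (simp add: field_simps power2_eq_square)
    have "(hl_single s z * (\<Prod>i\<in>I. hl_pair t (y i * z)) + hl_single s (inverse z) * (\<Prod>i\<in>I. hl_pair t (y i * inverse z))
      - (z + inverse z)) * (z * (1 - z) * ?D)
      = (hl_single s z * (z * (1 - z))) * (((\<Prod>i\<in>I. hl_pair t (y i * z)) * (\<Prod>i\<in>I. z - inverse (y i))) * (\<Prod>i\<in>I. z - y i))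
      + (hl_single s (inverse z) * (z * (1 - z))) * (((\<Prod>i\<in>I. hl_pair t (y i * inverse z)) * (\<Prod>i\<in>I. z - y i)) * (\<Prod>i\<in>I. z - inverse (y i)))
      - ((z + inverse z) * (z * (1 - z))) * ((\<Prod>i\<in>I. z - y i) * (\<Prod>i\<in>I. z - inverse (y i)))"
      unfolding D by (simp add: ring_distribs mult_ac)
    also have "\<dots> = poly (hlnum t s I y) z"
      unfolding 1 2 3 4 5 poly_hlnum by (simp add: mult_ac)
    finally show ?thesis .
  qed
  from this[OF refl] show ?thesis
    unfolding hlsum_insert[OF I] hlsum_def[of t s I] sum_distrib_left sum_distrib_right
      sum_subtractf[symmetric] z_def[symmetric]
    by (intro sum.cong refl) (simp only: mult.commute[of "z + inverse z"] right_diff_distrib[symmetric] mult.assoc[of "hlterm t s I _"])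
qed

text \<open>As a function of \<open>x m\<close>, the only poles of \<open>hlsum\<close> are the simple poles at 0 and \<open>\<infinity>\<close>
  with coefficient \<open>hlsum\<close> of the other variables.\<close>

lemma hlsum_insert_affine:
  assumes I: "finite I" "m \<notin> I" and gen: "hl_regular_strict I x"
    and gen1: "hl_regular (insert m I) x" and gen2: "hl_regular (insert m I) (x(m := z))"
  shows "hlsum t s (insert m I) x - (x m + inverse (x m)) * hlsum t s I x
    = hlsum t s (insert m I) (x(m := z)) - (z + inverse z) * hlsum t s I x"
proof -
  define K where "K = (\<Sum>E\<in>Pow I. smult (hlterm t s I (flip E x)) (hlnum t s I (flip E x)))"
  define Q where "Q = [:0, 1:] * [:1, -1:] * ((\<Prod>i\<in>I. [:- x i, 1:]) * (\<Prod>i\<in>I. [:- inverse (x i), 1:]))"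
  define A where "A = {0, 1} \<union> (x ` I \<union> inverse ` x ` I)"
  have K: "poly K a = (\<Sum>E\<in>Pow I. hlterm t s I (flip E x) * poly (hlnum t s I (flip E x)) a)" for a
    by (simp add: K_def poly_sum)
  have Q: "poly Q a = a * (1 - a) * (\<Prod>i\<in>I. (a - x i) * (a - inverse (x i)))" for a
    unfolding Q_def poly_mult poly_prod prod.distrib by simp
  have degK: "degree K \<le> 2 * card I + 2"
    unfolding K_def using I(1)
    by (intro degree_sum_le order.trans[OF degree_smult_le degree_hlnum]) simp
  have degQ: "degree Q \<le> 2 * card I + 2"
  proof -
    have "degree Q \<le> 1 + 1 + (card I + card I)"
      unfolding Q_def
      by (intro order.trans[OF degree_mult_le] add_mono) (auto simp: prod_linear_poly)
    then show ?thesis by simp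
  qed
  have wgen: "hl_regular I x"
    using gen by (simp add: hl_regular_strict_def)
  have nz: "x i \<noteq> 0" "x i \<noteq> 1" "x i \<noteq> -1" if "i \<in> I" for i
    using gen that by (auto simp: hl_regular_strict_def hl_regular_def)
  have sep: "x i \<noteq> x j" "x i * x j \<noteq> 1" if "i \<in> I" "j \<in> I" "i \<noteq> j" for i j
    using wgen that by (auto simp: hl_regular_def)
  have sq: "x i * x i \<noteq> 1" if "i \<in> I" for i
    using nz[OF that] by (metis square_eq_1_iff)
  have "card A = 2 * card I + 2"
  proof -
    have "inj_on x I"
      using sep by (auto simp: inj_on_def)
    moreover from this have "card (inverse ` x ` I) = card (x ` I)"
      by (intro card_image) (auto simp: inj_on_def)
    \<comment> \<open>For \<open>i = j\<close> strictness enters: a value -1 would be its own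
      inverse, and \<open>A\<close> would have too few points.\<close>
    moreover have "x i \<noteq> inverse (x j)" if "i \<in> I" "j \<in> I" for i j
      using sep[OF that] sq[OF that(1)] nz that by (cases "i = j") (auto simp: field_simps)
    then have "x ` I \<inter> inverse ` x ` I = {}"
      by auto
    ultimately have "card (x ` I \<union> inverse ` x ` I) = 2 * card I"
      using I(1) by (simp add: card_Un_disjoint card_image)
    moreover have "card ({0, 1 :: 'a}) = 2" by simp
    moreover have "{0, 1} \<inter> (x ` I \<union> inverse ` x ` I) = {}"
      using nz by (auto simp: image_iff)
    ultimately show ?thesis
      unfolding A_def using I(1) by (subst card_Un_disjoint) auto
  qed
  have finA: "finite A"
    using I(1) by (simp add: A_def)
  have vanish: "poly K a = 0 \<and> poly Q a = 0" if "a \<in> A" for a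
    using that sum_poly_hlnum_eq_0[OF I(1) wgen, of a] I(1) unfolding K Q A_def by auto
  have Qnz: "poly Q (y m) \<noteq> 0" if "hl_regular (insert m I) y" "\<And>i. i \<in> I \<Longrightarrow> y i = x i" for y
  proof -
    have "y m \<noteq> 0" "y m \<noteq> 1"
      using that(1) by (auto simp: hl_regular_def)
    moreover have "y m \<noteq> x i \<and> y m \<noteq> inverse (x i)" if "i \<in> I" for i
    proof -
      have "y m \<noteq> y i" "y m * y i \<noteq> 1"
        using that I \<open>hl_regular (insert m I) y\<close> unfolding hl_regular_def by (metis insertCI)+
      then show ?thesis
        using nz(1)[OF that] \<open>\<And>i. i \<in> I \<Longrightarrow> y i = x i\<close>[OF that] by (auto simp: field_simps)
    qed
    ultimately show ?thesis
      using I(1) unfolding Q by auto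
  qed
  have eq: "(hlsum t s (insert m I) y - (y m + inverse (y m)) * hlsum t s I x) * poly Q (y m) = poly K (y m)"
    if "hl_regular (insert m I) y" "\<And>i. i \<in> I \<Longrightarrow> y i = x i" for y
  proof -
    have *: "hlsum t s I y = hlsum t s I x" "(\<Prod>i\<in>I. (y m - y i) * (y m - inverse (y i))) = (\<Prod>i\<in>I. (y m - x i) * (y m - inverse (x i)))"
      "\<And>E. hlterm t s I (flip E y) = hlterm t s I (flip E x)"
      "\<And>E. hlnum t s I (flip E y) = hlnum t s I (flip E x)"
      using that(2) by (auto intro!: hlsum_cong hlterm_cong hlnum_cong simp: flip_def)
    show ?thesis
      using hlsum_insert_eq_hlnum[OF I that(1), of t s] unfolding * Q K .
  qed
  let ?x' = "x(m := z)"
  have 1: "poly Q (x m) \<noteq> 0" "(hlsum t s (insert m I) x - (x m + inverse (x m)) * hlsum t s I x) * poly Q (x m) = poly K (x m)"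
    using Qnz[OF gen1 refl] eq[OF gen1 refl] .
  have 2: "poly Q z \<noteq> 0" "(hlsum t s (insert m I) ?x' - (z + inverse z) * hlsum t s I x) * poly Q z = poly K z"
  proof -
    have "poly Q (?x' m) \<noteq> 0"
      by (rule Qnz[OF gen2]) (use I(2) in auto)
    moreover have "(hlsum t s (insert m I) ?x' - (?x' m + inverse (?x' m)) * hlsum t s I x)
        * poly Q (?x' m) = poly K (?x' m)"
      by (rule eq[OF gen2]) (use I(2) in auto)
    ultimately show "poly Q z \<noteq> 0"
      "(hlsum t s (insert m I) ?x' - (z + inverse z) * hlsum t s I x) * poly Q z = poly K z"
      by (simp_all only: fun_upd_same not_False_eq_True)
  qed
  have "x m \<notin> A"
    using vanish 1(1) by auto
  \<comment> \<open>\<open>K\<close> and \<open>Q\<close> vanish on \<open>A\<close>, which has as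
    many points as the degree bound allows zeros. Agreement at the further point \<open>x m\<close>
    makes the two multiples equal, so the quotient of \<open>K\<close> by \<open>Q\<close> is
    constant.\<close>
  have "smult (poly Q (x m)) K = smult (poly K (x m)) Q"
  proof (rule poly_eqI_degree[of "insert (x m) A"])
    show "poly (smult (poly Q (x m)) K) a = poly (smult (poly K (x m)) Q) a" if "a \<in> insert (x m) A" for a
      using that vanish by auto
    show "degree (smult (poly Q (x m)) K) < card (insert (x m) A)" "degree (smult (poly K (x m)) Q) < card (insert (x m) A)"
      using degK degQ degree_smult_le[of "poly Q (x m)" K] degree_smult_le[of "poly K (x m)" Q]
        \<open>card A = _\<close> \<open>x m \<notin> A\<close> finA by (auto simp del: degree_smult_eq)
  qed
  then have "poly Q (x m) * poly K z = poly K (x m) * poly Q z"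
    by (metis poly_smult)
  then have "poly Q (x m) * poly Q z * (hlsum t s (insert m I) ?x' - (z + inverse z) * hlsum t s I x)
    = poly Q (x m) * poly Q z * (hlsum t s (insert m I) x - (x m + inverse (x m)) * hlsum t s I x)"
    unfolding 1(2)[symmetric] 2(2)[symmetric] by (simp add: mult_ac)
  then show ?thesis
    using 1(1) 2(1) by simp
qed

subsection \<open>Sums of elementary symmetric functions\<close>

text \<open>The coefficient of \<open>z ^ k\<close> in the product of \<open>p\<close> and the formal Laurent series with coefficients \<open>\<phi>\<close>.\<close>

definition pconv :: "(int \<Rightarrow> 'a::field) \<Rightarrow> int \<Rightarrow> 'a poly \<Rightarrow> 'a" where
  "pconv \<phi> k p = (\<Sum>i\<le>degree p. coeff p i * \<phi> (k - int i))"

lemma pconv_eq_sum: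
  assumes "degree p \<le> N"
  shows "pconv \<phi> k p = (\<Sum>i\<le>N. coeff p i * \<phi> (k - int i))"
  unfolding pconv_def using assms
  by (intro sum.mono_neutral_left) (auto simp: coeff_eq_0)

lemma pconv_add: "pconv \<phi> k (p + q) = pconv \<phi> k p + pconv \<phi> k q"
proof -
  let ?N = "max (degree p) (degree q)"
  have "degree (p + q) \<le> ?N" by (rule degree_add_le_max)
  then show ?thesis
    by (simp add: pconv_eq_sum[of _ ?N] sum.distrib distrib_right)
qed

lemma pconv_smult: "pconv \<phi> k (smult a p) = a * pconv \<phi> k p"
  using pconv_eq_sum[OF degree_smult_le[of a p]]
  by (simp add: pconv_def sum_distrib_left mult.assoc)

lemma pconv_pCons: "pconv \<phi> k (pCons a p) = a * \<phi> k + pconv \<phi> (k - 1) p"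
proof -
  have "pconv \<phi> k (pCons a p) = (\<Sum>i\<le>Suc (degree p). coeff (pCons a p) i * \<phi> (k - int i))"
    by (rule pconv_eq_sum) (rule degree_pCons_le)
  also have "\<dots> = a * \<phi> k + (\<Sum>i\<le>degree p. coeff p i * \<phi> (k - int (Suc i)))"
    by (subst sum.atMost_Suc_shift) simp
  finally show ?thesis
    by (simp add: pconv_def algebra_simps)
qed

lemma pconv_mult_linear:
  "pconv \<phi> k ([:a, b:] * p) = a * pconv \<phi> k p + b * pconv \<phi> (k - 1) p"
  by (simp add: pconv_add pconv_smult pconv_pCons)

lemma pconv_1: "pconv \<phi> k 1 = \<phi> k"
  by (simp add: pconv_def)

text \<open>Passing from \<phi> to \<open>\<phi> j + \<phi> (j + 1)\<close> multiplies the series by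
  \<open>1 + 1/z\<close>; this produces the two neighbouring elementary symmetric functions in the
  first two identities.\<close>

lemma pconv_plus_shift:
  "pconv (\<lambda>j. \<phi> j + \<phi> (j + 1)) k p = pconv \<phi> k p + pconv \<phi> (k + 1) p"
  by (simp add: pconv_def sum.distrib algebra_simps)

text \<open>The hypothesis says that the series \<Phi> with coefficients \<phi> satisfies
  \<open>\<Phi>(z) = \<rho> z^\<kappa> \<Phi>(t z)\<close>. The claim compares coefficients in
  \<open>p(t z) \<Phi>(z) = \<rho> z^\<kappa> p(t z) \<Phi>(t z)\<close>.\<close>

lemma pconv_pcompose_scale:
  fixes t :: "'a::field"
  assumes "t \<noteq> 0" "\<And>j. \<phi> (j + \<kappa>) = \<rho> * t powi j * \<phi> j"
  shows "pconv \<phi> k (pcompose p [:0, t:]) = \<rho> * t powi (k - \<kappa>) * pconv \<phi> (k - \<kappa>) p"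
proof -
  have "degree (pcompose p [:0, t:]) = degree p"
    using assms(1) by (simp add: degree_pcompose)
  moreover have "t ^ i * \<phi> (k - int i) = \<rho> * t powi (k - \<kappa>) * \<phi> (k - \<kappa> - int i)" for i
  proof -
    have "\<phi> (k - int i) = \<rho> * t powi (k - \<kappa> - int i) * \<phi> (k - \<kappa> - int i)"
      using assms(2)[of "k - \<kappa> - int i"] by simp
    moreover have "t ^ i * t powi (k - \<kappa> - int i) = t powi (k - \<kappa>)"
      using assms(1) by (simp add: power_int_diff)
    ultimately show ?thesis
      by (metis mult.assoc mult.left_commute)
  qed
  then have "coeff (pcompose p [:0, t:]) i * \<phi> (k - int i)
      = \<rho> * t powi (k - \<kappa>) * (coeff p i * \<phi> (k - \<kappa> - int i))" for i
    unfolding coeff_pcompose_linear by (metis mult.assoc mult.left_commute)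
  ultimately show ?thesis
    unfolding pconv_def sum_distrib_left by simp
qed

definition egen :: "nat set \<Rightarrow> (nat \<Rightarrow> 'a::field) \<Rightarrow> 'a poly" where
  "egen I x = (\<Prod>i\<in>I. [:1, x i:] * [:1, inverse (x i):])"

lemma esym_eq_coeff:
  fixes f :: "'i \<Rightarrow> 'a::comm_ring_1"
  assumes "finite S"
  shows "esym S f r = (if r < 0 then 0 else coeff (\<Prod>i\<in>S. [:1, f i:]) (nat r))"
proof -
  have "(\<Prod>i\<in>S. [:1, f i:]) = (\<Prod>i\<in>S. monom (f i) 1 + 1)"
    by (intro prod.cong) (simp_all add: monom_altdef one_pCons)
  also have "\<dots> = (\<Sum>X\<in>Pow S. monom (\<Prod>i\<in>X. f i) (card X))"
  proof -
    have "(\<Prod>i\<in>X. monom (f i) 1) = monom (\<Prod>i\<in>X. f i) (card X)" for X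
      by (induction X rule: infinite_finite_induct) (simp_all add: mult_monom one_pCons monom_0)
    then show ?thesis
      unfolding prod_add[OF assms] by simp
  qed
  finally have "coeff (\<Prod>i\<in>S. [:1, f i:]) k = (\<Sum>X\<in>Pow S. if card X = k then \<Prod>i\<in>X. f i else 0)" for k
    by (simp add: coeff_sum)
  also have "\<dots> k = (\<Sum>X | X \<in> Pow S \<and> card X = k. \<Prod>i\<in>X. f i)" for k
    using assms by (intro sum.inter_filter[symmetric]) simp
  finally have *: "coeff (\<Prod>i\<in>S. [:1, f i:]) k = (\<Sum>X | X \<in> Pow S \<and> card X = k. \<Prod>i\<in>X. f i)" for k .
  show ?thesis
  proof (cases "r < 0")
    case True
    then have "{A. A \<subseteq> S \<and> int (card A) = r} = {}" by auto
    then show ?thesis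
      unfolding esym_def using True by (simp only: sum.empty if_True)
  next
    case False
    then show ?thesis
      unfolding esym_def * by (auto intro!: sum.cong)
  qed
qed

lemma edot_eq_coeff:
  "edot n x r = (if r < 0 then 0 else coeff (egen {1..n} x) (nat r))"
proof -
  have "(\<Prod>k\<in>{1..n} \<times> UNIV. [:1, case k of (i, b) \<Rightarrow> if b then inverse (x i) else x i:])
      = egen {1..n} x"
  proof -
    have "egen {1..n} x = (\<Prod>i\<in>{1..n}. \<Prod>b\<in>UNIV. [:1, if b then inverse (x i) else x i:])"
      unfolding egen_def UNIV_bool by simp
    also have "\<dots> = (\<Prod>k\<in>{1..n} \<times> UNIV. [:1, case k of (i, b) \<Rightarrow> if b then inverse (x i) else x i:])"
      unfolding prod.cartesian_product by (rule prod.cong) auto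
    finally show ?thesis ..
  qed
  then show ?thesis
    unfolding edot_def by (subst esym_eq_coeff) auto
qed

text \<open>The coefficients of the series with terms \<open>c y * z ^ (\<kappa> * y)\<close>.\<close>

definition stretch :: "int \<Rightarrow> (int \<Rightarrow> 'a::field) \<Rightarrow> int \<Rightarrow> 'a" where
  "stretch \<kappa> c j = (if \<kappa> dvd j then c (j div \<kappa>) else 0)"

text \<open>Substituting \<open>i = k - \<kappa> * y\<close> turns the sum over \<open>y\<close>
  into one over the exponents \<open>i\<close> of the generating polynomial that are congruent to
  \<open>k\<close> modulo \<kappa>.\<close>

lemma Sum_any_edot:
  fixes x :: "nat \<Rightarrow> 'a::field"
  assumes "\<kappa> > 0"
  shows "finite {y. c y * edot n x (k - \<kappa> * y) \<noteq> 0}"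
    and "(\<Sum>y. c y * edot n x (k - \<kappa> * y))
      = pconv (stretch \<kappa> c) k (egen {1..n} x)"
proof -
  let ?p = "egen {1..n} x"
  define S where "S = {i. i \<le> degree ?p \<and> \<kappa> dvd k - int i}"
  let ?h = "\<lambda>i. (k - int i) div \<kappa>"
  have "finite S"
    by (simp add: S_def)
  have sub: "{y. c y * edot n x (k - \<kappa> * y) \<noteq> 0} \<subseteq> ?h ` S"
  proof
    fix y assume "y \<in> {y. c y * edot n x (k - \<kappa> * y) \<noteq> 0}"
    then have "0 \<le> k - \<kappa> * y" "coeff ?p (nat (k - \<kappa> * y)) \<noteq> 0"
      by (auto simp: edot_eq_coeff split: if_splits)
    then have "nat (k - \<kappa> * y) \<in> S" "y = ?h (nat (k - \<kappa> * y))"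
      using assms by (auto simp: S_def intro: le_degree)
    then show "y \<in> ?h ` S" by blast
  qed
  then show "finite {y. c y * edot n x (k - \<kappa> * y) \<noteq> 0}"
    using \<open>finite S\<close> finite_surj by blast
  have inj: "inj_on ?h S"
    using assms by (auto simp: S_def inj_on_def dvd_div_eq_iff)
  have "(\<Sum>y. c y * edot n x (k - \<kappa> * y)) = (\<Sum>y\<in>?h ` S. c y * edot n x (k - \<kappa> * y))"
    by (rule Sum_any.expand_superset) (use \<open>finite S\<close> sub in auto)
  also have "\<dots> = (\<Sum>i\<in>S. coeff ?p i * c (?h i))"
    unfolding sum.reindex[OF inj]
    by (rule sum.cong) (auto simp: S_def edot_eq_coeff)
  also have "\<dots> = (\<Sum>i\<le>degree ?p. if \<kappa> dvd k - int i then coeff ?p i * c (?h i) else 0)"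
    unfolding S_def by (subst sum.inter_filter[symmetric]) auto
  also have "\<dots> = pconv (stretch \<kappa> c) k ?p"
    unfolding pconv_def stretch_def by (rule sum.cong) auto
  finally show "(\<Sum>y. c y * edot n x (k - \<kappa> * y)) = \<dots>" .
qed

definition edotsum :: "(int \<Rightarrow> 'a::field) \<Rightarrow> nat set \<Rightarrow> (nat \<Rightarrow> 'a) \<Rightarrow> 'a" where
  "edotsum \<omega> I x = pconv \<omega> (int (card I)) (egen I x)"

lemma egen_insert:
  assumes "finite I" "m \<notin> I"
  shows "egen (insert m I) x = [:1, x m:] * ([:1, inverse (x m):] * egen I x)"
  unfolding egen_def prod.insert[OF assms] by (simp only: mult.assoc)

text \<open>Since \<open>(1 + x z) (1 + z/x) = 1 + (x + 1/x) z + z^2\<close>, only the middle term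
  carries \<open>x m\<close>. This is the shape that \<open>hlsum_insert_affine\<close> gives for
  the sum over signs.\<close>

lemma edotsum_insert:
  assumes "finite I" "m \<notin> I" "x m \<noteq> 0"
  shows "edotsum \<omega> (insert m I) x = (x m + inverse (x m)) * edotsum \<omega> I x
    + (pconv \<omega> (int (card I) + 1) (egen I x) + pconv \<omega> (int (card I) - 1) (egen I x))"
  using assms unfolding edotsum_def egen_insert[OF assms(1,2)] pconv_mult_linear
  by (simp add: algebra_simps)

lemma egen_cong: "(\<And>i. i \<in> I \<Longrightarrow> x i = y i) \<Longrightarrow> egen I x = egen I y"
  unfolding egen_def by (rule prod.cong) auto

lemma edotsum_cong: "(\<And>i. i \<in> I \<Longrightarrow> x i = y i) \<Longrightarrow> edotsum \<omega> I x = edotsum \<omega> I y"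
  unfolding edotsum_def by (metis egen_cong)

lemma edotsum_image:
  assumes "inj_on h J"
  shows "edotsum \<omega> (h ` J) x = edotsum \<omega> J (x \<circ> h)"
  unfolding edotsum_def egen_def card_image[OF assms] by (simp only: prod.reindex[OF assms] comp_def)

lemma hl_regular_strict_image:
  assumes "inj_on h J"
  shows "hl_regular_strict (h ` J) x \<longleftrightarrow> hl_regular_strict J (x \<circ> h)"
  unfolding hl_regular_strict_def hl_regular_def by (auto simp: inj_on_eq_iff[OF assms])

subsection \<open>Independence of the difference of the variables\<close>

definition hldiff :: "'a::field \<Rightarrow> 'a \<Rightarrow> (int \<Rightarrow> 'a) \<Rightarrow> nat set \<Rightarrow> (nat \<Rightarrow> 'a) \<Rightarrow> 'a" where
  "hldiff t s \<omega> I x = hlsum t s I x - edotsum \<omega> I x"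

lemma hldiff_cong: "(\<And>i. i \<in> I \<Longrightarrow> x i = y i) \<Longrightarrow> hldiff t s \<omega> I x = hldiff t s \<omega> I y"
  unfolding hldiff_def using hlsum_cong edotsum_cong by metis

lemma hldiff_image:
  assumes "finite J" "inj_on h J"
  shows "hldiff t s \<omega> (h ` J) x = hldiff t s \<omega> J (x \<circ> h)"
  unfolding hldiff_def hlsum_image[OF assms] edotsum_image[OF assms(2)] ..

text \<open>On both sides \<open>x m + inverse (x m)\<close> is multiplied by the value for
  \<open>I\<close>, and the remainder is free of \<open>x m\<close>. The hypothesis \<open>0\<close>
  makes the two values for \<open>I\<close> equal, so \<open>x m\<close> drops out of the
  difference.\<close>

lemma hldiff_update:
  assumes I: "finite I" "m \<notin> I" and gen: "hl_regular_strict I x"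
    and gen1: "hl_regular (insert m I) x" and gen2: "hl_regular (insert m I) (x(m := z))"
    and 0: "hldiff t s \<omega> I x = 0"
  shows "hldiff t s \<omega> (insert m I) (x(m := z)) = hldiff t s \<omega> (insert m I) x"
proof -
  have "x m \<noteq> 0" "z \<noteq> 0"
    using gen1 gen2 by (auto simp: hl_regular_def)
  moreover have "egen I (x(m := z)) = egen I x" "edotsum \<omega> I (x(m := z)) = edotsum \<omega> I x"
    using I(2) by (auto intro!: egen_cong edotsum_cong)
  moreover have "hlsum t s I x = edotsum \<omega> I x"
    using 0 by (simp add: hldiff_def)
  ultimately show ?thesis
    using hlsum_insert_affine[OF I gen gen1 gen2, of t s] I
    by (simp add: hldiff_def edotsum_insert)
qed

text \<open>Changing coordinate \<open>j\<close> requires strictness of the other coordinates only,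
  so \<open>p j\<close> itself may be -1.\<close>

lemma hldiff_override_insert:
  assumes I: "finite I"
    and IH: "\<And>j x. j \<in> I \<Longrightarrow> hl_regular_strict (I - {j}) x \<Longrightarrow> hldiff t s \<omega> (I - {j}) x = 0"
    and q: "hl_regular_strict I q" and p: "hl_regular I p"
    and sep: "\<And>i j. i \<in> I \<Longrightarrow> j \<in> I \<Longrightarrow> q i \<noteq> p j \<and> q i * p j \<noteq> 1"
    and J: "J \<subseteq> I" "j \<in> I" "j \<notin> J" "\<And>i. i \<in> J \<Longrightarrow> p i \<noteq> -1"
  shows "hldiff t s \<omega> I (override_on q p (insert j J)) = hldiff t s \<omega> I (override_on q p J)"
proof -
  have wgen: "hl_regular I (override_on q p J')" if "J' \<subseteq> I" for J'
    using q p sep that unfolding hl_regular_strict_def hl_regular_def override_on_def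
    by (smt (verit) mult.commute)
  have "hl_regular I (override_on q p (insert j J))" "hl_regular I (override_on q p J)"
    using J by (auto intro: wgen)
  moreover have sgen: "hl_regular_strict (I - {j}) (override_on q p J)"
    using wgen[OF J(1)] J q unfolding hl_regular_strict_def hl_regular_def by (auto simp: override_on_def)
  moreover have "insert j (I - {j}) = I"
    using J(2) by blast
  ultimately show ?thesis
    using hldiff_update[of "I - {j}" j "override_on q p J" "p j" t s \<omega>] I IH[OF J(2) sgen]
    by (simp add: override_on_insert)
qed

lemma hldiff_override:
  assumes I: "finite I"
    and IH: "\<And>j x. j \<in> I \<Longrightarrow> hl_regular_strict (I - {j}) x \<Longrightarrow> hldiff t s \<omega> (I - {j}) x = 0"
    and q: "hl_regular_strict I q" and p: "hl_regular I p"
    and sep: "\<And>i j. i \<in> I \<Longrightarrow> j \<in> I \<Longrightarrow> q i \<noteq> p j \<and> q i * p j \<noteq> 1"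
    and J: "J \<subseteq> I" "\<And>i. i \<in> J \<Longrightarrow> p i \<noteq> -1"
  shows "hldiff t s \<omega> I (override_on q p J) = hldiff t s \<omega> I q"
proof -
  have "finite J"
    using J(1) I by (rule finite_subset)
  then show ?thesis
    using J
  proof (induction J)
    case (insert j J)
    then have "hldiff t s \<omega> I (override_on q p (insert j J)) = hldiff t s \<omega> I (override_on q p J)"
      by (intro hldiff_override_insert[OF I IH q p sep]) auto
    with insert show ?case by simp
  qed simp
qed

text \<open>Supplies an intermediate point from which two given points can both be reached one
  coordinate at a time.\<close>

lemma ex_hl_regular_strict_avoiding:
  fixes B :: "'a::field_char_0 set"
  assumes "finite B"
  obtains q :: "nat \<Rightarrow> 'a" where "hl_regular_strict I q" "\<And>i. q i \<notin> B"
proof -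
  have "finite ((of_nat :: nat \<Rightarrow> 'a) -` B)"
    using assms by (rule finite_vimageI) (rule inj_of_nat)
  then obtain M where M: "\<And>m. of_nat m \<in> B \<Longrightarrow> m < M"
    by (auto simp: finite_nat_set_iff_bounded)
  \<comment> \<open>Distinct integers from 2 on are never -1 and have no product 1; starting beyond
    \<open>M\<close> keeps them out of \<open>B\<close>.\<close>
  define q :: "nat \<Rightarrow> 'a" where "q i = of_nat (M + i + 2)" for i
  have ne: "(of_nat m :: 'a) \<noteq> -1" for m
    by (metis add_eq_0_iff of_nat_Suc of_nat_eq_0_iff nat.distinct(1))
  have eq1: "of_nat a * of_nat b = (1 :: 'a) \<longleftrightarrow> a * b = 1" for a b
    by (metis of_nat_1 of_nat_eq_iff of_nat_mult)
  have "q i \<noteq> -1" for i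
    unfolding q_def by (rule ne)
  moreover have "q i \<noteq> 0" "q i \<noteq> 1" "q i = q j \<longleftrightarrow> i = j" "q i * q j \<noteq> 1" for i j
    unfolding q_def eq1 of_nat_eq_iff of_nat_eq_1_iff of_nat_eq_0_iff by simp_all
  ultimately have "hl_regular_strict I q"
    unfolding hl_regular_strict_def hl_regular_def by simp
  moreover have "q i \<notin> B" for i
    using M[of "M + i + 2"] by (auto simp: q_def)
  ultimately show ?thesis by (rule that)
qed

subsection \<open>The base point\<close>

definition basept :: "'a::field \<Rightarrow> nat \<Rightarrow> 'a" where
  "basept t i = - (t ^ i)"

definition nonroot :: "'a::field \<Rightarrow> bool" where
  "nonroot t \<longleftrightarrow> t \<noteq> 0 \<and> (\<forall>k\<ge>1. t ^ k \<noteq> 1)"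

lemma nonroot_power_ne_minus_1:
  assumes "nonroot (t :: 'a::field_char_0)"
  shows "t ^ k \<noteq> -1"
proof
  assume *: "t ^ k = -1"
  then have "t ^ (2 * k) = 1"
    by (simp add: power_mult power2_eq_square power_mult_distrib mult.commute[of 2])
  moreover have "k \<noteq> 0"
    using * by (intro notI) simp
  ultimately show False
    using assms by (auto simp: nonroot_def)
qed

lemma nonroot_power_eq_iff:
  assumes "nonroot t"
  shows "t ^ i = t ^ j \<longleftrightarrow> i = j"
proof -
  have "t ^ i \<noteq> t ^ j" if "i < j" for i j
  proof
    assume "t ^ i = t ^ j"
    also have "t ^ j = t ^ i * t ^ (j - i)"
      using that by (simp flip: power_add)
    finally show False
      using assms that by (simp add: nonroot_def)
  qed
  then show ?thesis
    by (metis nat_neq_iff)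
qed

text \<open>Strictness cannot be claimed, because the coordinate 0 is -1.\<close>

lemma hl_regular_basept:
  assumes "nonroot (t :: 'a::field_char_0)"
  shows "hl_regular I (basept t)"
proof -
  have "- (t ^ i) \<noteq> 1" for i
    using nonroot_power_ne_minus_1[OF assms, of i] by (metis minus_minus)
  moreover have "t ^ i * t ^ j \<noteq> 1" if "i \<noteq> j" for i j
    using assms that by (auto simp: nonroot_def simp flip: power_add)
  ultimately show ?thesis
    using assms nonroot_power_eq_iff[OF assms] by (auto simp: hl_regular_def basept_def nonroot_def)
qed

text \<open>At the base point \<open>x i = - t ^ i\<close>, a factor \<open>hl_pair t (inverse t)\<close> annihilates every choice of
  signs apart from the inversions of \<open>x 0 = - 1\<close>.\<close>

lemma hlsum_basept:
  assumes "nonroot t" "n \<ge> 1"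
  shows "hlsum t s {..<n} (basept t) = 2 * hlterm t s {..<n} (basept t)"
proof -
  have "hlterm t s {..<n} (flip E (basept t)) = 0" if "E \<in> Pow {..<n} - {{}, {0}}" for E
  proof -
    \<comment> \<open>Let \<open>i\<close> be the least inverted index other than 0. Its predecessor
      either is not inverted or is 0, where inverting -1 changes nothing; hence the two values have
      the product \<open>inverse t\<close>.\<close>
    define i where "i = Min (E - {0})"
    have "finite (E - {0})" "E - {0} \<noteq> {}"
      using that finite_subset[of E "{..<n}"] by auto
    then have i: "i \<in> E" "i \<noteq> 0" and min: "\<And>k. k \<in> E - {0} \<Longrightarrow> i \<le> k"
      using Min_in[of "E - {0}"] by (auto simp: i_def)
    have "i < n"
      using that i(1) by auto
    have "flip E (basept t) (i - 1) = - (t ^ (i - 1))"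
    proof -
      have "i - 1 = 0 \<or> i - 1 \<notin> E"
        using min[of "i - 1"] i(2) by force
      then show ?thesis
        by (auto simp: flip_def basept_def)
    qed
    moreover have "flip E (basept t) i = - inverse (t ^ i)"
      using i by (simp add: flip_def basept_def)
    moreover have "t ^ i = t * t ^ (i - 1)"
      using i(2) by (metis power_eq_if)
    moreover have "t \<noteq> 0"
      using assms by (simp add: nonroot_def)
    ultimately have "flip E (basept t) (i - 1) * flip E (basept t) i = inverse t"
      by (simp add: field_simps)
    then have "hl_pair t (flip E (basept t) (i - 1) * flip E (basept t) i) = 0"
      using \<open>t \<noteq> 0\<close> by (simp add: hl_pair_def)
    moreover have "(i - 1, i) \<in> pairs {..<n}"
      using i(2) \<open>i < n\<close> by (auto simp: pairs_def)
    moreover have "finite (pairs {..<n})"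
      by (simp add: finite_pairs)
    ultimately have "(\<Prod>(i, j)\<in>pairs {..<n}. hl_pair t (flip E (basept t) i * flip E (basept t) j)) = 0"
      by (intro prod_zero) (auto intro!: bexI[of _ "(i - 1, i)"])
    then show ?thesis
      by (simp add: hlterm_def)
  qed
  then have "hlsum t s {..<n} (basept t) = (\<Sum>E\<in>{{}, {0}}. hlterm t s {..<n} (flip E (basept t)))"
    unfolding hlsum_def using assms(2) by (intro sum.mono_neutral_right) auto
  moreover have "flip {} (basept t) = basept t" "flip {0} (basept t) = basept t"
    by (auto simp: flip_def basept_def fun_eq_iff)
  ultimately show ?thesis
    by simp
qed

text \<open>The pair factors with the new index telescope to
  \<open>(1 - t^(2n)) / (1 - t^n) = 1 + t^n\<close>, which cancels the denominator
  \<open>1 + t^n\<close> of the new \<open>hl_single\<close>.\<close>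

lemma hlterm_basept_Suc:
  assumes "nonroot (t :: 'a::field_char_0)" "n \<ge> 1"
  shows "hlterm t s {..<Suc n} (basept t)
    = - inverse (t ^ n) * (1 + s * t ^ n) * hlterm t s {..<n} (basept t)"
proof -
  have ne: "t ^ k \<noteq> 1" if "k \<ge> 1" for k
    using assms that by (simp add: nonroot_def)
  have "(\<Prod>i<m. hl_pair t (basept t i * basept t n)) = (1 - t ^ (m + n)) / (1 - t ^ n)" for m
  proof (induction m)
    case (Suc m)
    have "t ^ (m + n) \<noteq> 1"
      using assms(2) by (intro ne) simp
    then show ?case
      using Suc by (simp add: hl_pair_def basept_def power_add[symmetric])
  qed (use ne[OF assms(2)] in simp)
  then have "(\<Prod>i<n. hl_pair t (basept t i * basept t n)) = (1 - t ^ (n + n)) / (1 - t ^ n)" .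
  also have "1 - t ^ (n + n) = (1 - t ^ n) * (1 + t ^ n)"
    by (simp add: power_add algebra_simps)
  finally have prd: "(\<Prod>i<n. hl_pair t (basept t i * basept t n)) = 1 + t ^ n"
    using ne[OF assms(2)] by simp
  have "1 + t ^ n \<noteq> 0"
    using nonroot_power_ne_minus_1[OF assms(1), of n] by (metis add_eq_0_iff)
  then have "hl_single s (basept t n) * (1 + t ^ n) = - inverse (t ^ n) * (1 + s * t ^ n)"
    using assms(1) by (simp add: hl_single_def basept_def nonroot_def divide_simps)
  then show ?thesis
    unfolding lessThan_Suc by (subst hlterm_insert) (simp_all add: prd)
qed

text \<open>The product of the \<open>1 - t^i z\<close> over \<open>-n < i < n\<close>. Index 0
  contributes the square of \<open>1 - z\<close> to \<open>egen\<close>; one of these factors is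
  split off here.\<close>

definition basepoly :: "'a::field \<Rightarrow> nat \<Rightarrow> 'a poly" where
  "basepoly t n = [:1, -1:] * (\<Prod>i\<in>{1..<n}. [:1, - (t ^ i):] * [:1, - inverse (t ^ i):])"

lemma basepoly_Suc:
  assumes "n \<ge> 1"
  shows "basepoly t (Suc n) = [:1, - (t ^ n):] * ([:1, - inverse (t ^ n):] * basepoly t n)"
  unfolding basepoly_def using assms
  by (simp only: atLeastLessThanSuc if_True prod.insert finite_atLeastLessThan atLeastLessThan_iff
      less_irrefl simp_thms mult_ac)

lemma egen_basept:
  assumes "n \<ge> 1"
  shows "egen {..<n} (basept t) = [:1, -1:] * basepoly t n"
proof -
  have "{..<n} = insert 0 {1..<n}"
    using assms by auto
  then have "egen {..<n} (basept t)
      = [:1, basept t 0:] * [:1, inverse (basept t 0):] * egen {1..<n} (basept t)"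
    by (simp only: egen_def) (subst prod.insert, auto)
  then show ?thesis
    by (simp only: basepoly_def egen_def basept_def power_0 inverse_minus_eq inverse_1 mult.assoc)
qed

text \<open>The substitution \<open>z \<mapsto> t * z\<close> shifts the product of the \<open>1 - t ^ i * z\<close>, \<open>- n \<le> i < n\<close>.\<close>

lemma pcompose_basepoly:
  assumes "t \<noteq> 0" "n \<ge> 1"
  shows "pcompose ([:1, - inverse (t ^ n):] * basepoly t n) [:0, t:] = [:1, - (t ^ n):] * basepoly t n"
  using assms(2)
proof (induction n rule: dec_induct)
  case base
  show ?case
    using assms(1) by (simp add: basepoly_def pcompose_mult pcompose_pCons field_simps)
next
  case (step n)
  have lin: "pcompose [:1, a:] [:0, t:] = [:1, a * t:]" for a
    by (simp add: pcompose_pCons)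
  have "pcompose ([:1, - inverse (t ^ Suc n):] * basepoly t (Suc n)) [:0, t:]
    = pcompose [:1, - inverse (t ^ Suc n):] [:0, t:] * (pcompose [:1, - (t ^ n):] [:0, t:]
        * pcompose ([:1, - inverse (t ^ n):] * basepoly t n) [:0, t:])"
    unfolding basepoly_Suc[OF step(1)] by (simp only: pcompose_mult)
  also have "\<dots> = [:1, - inverse (t ^ n):] * ([:1, - (t ^ Suc n):] * ([:1, - (t ^ n):] * basepoly t n))"
  proof -
    have "- inverse (t ^ Suc n) * t = - inverse (t ^ n)" "- (t ^ n) * t = - (t ^ Suc n)"
      using assms(1) by simp_all
    then show ?thesis
      by (simp only: step.IH lin)
  qed
  also have "\<dots> = [:1, - (t ^ Suc n):] * basepoly t (Suc n)"
    unfolding basepoly_Suc[OF step(1)] by (simp only: mult_ac)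
  finally show ?case .
qed

text \<open>Combines the quasi-periodicity of the series with the shift of the product under
  \<open>z \<mapsto> t z\<close>. The recursions in \<open>n\<close> on the theta side rest on this
  relation.\<close>

lemma pconv_basepoly_shift:
  fixes t :: "'a::field"
  assumes "t \<noteq> 0" "n \<ge> 1" "\<And>j. \<phi> (j + \<kappa>) = \<rho> * t powi j * \<phi> j"
  shows "pconv \<phi> k (basepoly t n) - t ^ n * pconv \<phi> (k - 1) (basepoly t n)
    = \<rho> * t powi (k - \<kappa>) *
      (pconv \<phi> (k - \<kappa>) (basepoly t n) - inverse (t ^ n) * pconv \<phi> (k - \<kappa> - 1) (basepoly t n))"
  using pconv_pcompose_scale[OF assms(1,3), of k "[:1, - inverse (t ^ n):] * basepoly t n"]
  unfolding pcompose_basepoly[OF assms(1,2)] pconv_mult_linear by simp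

lemma edotsum_basept:
  assumes "n \<ge> 1"
  shows "edotsum \<omega> {..<n} (basept t) = pconv \<omega> (int n) (basepoly t n) - pconv \<omega> (int n - 1) (basepoly t n)"
  by (simp only: edotsum_def card_lessThan egen_basept[OF assms] pconv_mult_linear) simp

text \<open>The coefficients are those of \<open>(1 - z) (1 - t^n z) (1 - z/t^n)\<close>.\<close>

lemma edotsum_basept_Suc:
  fixes t :: "'a::field" and \<omega> :: "int \<Rightarrow> 'a"
  assumes "t \<noteq> 0" "n \<ge> 1"
  defines "L \<equiv> \<lambda>k. pconv \<omega> k (basepoly t n)"
  shows "edotsum \<omega> {..<Suc n} (basept t)
    = L (int n + 1) - (1 + t ^ n + inverse (t ^ n)) * L (int n)
      + (1 + t ^ n + inverse (t ^ n)) * L (int n - 1) - L (int n - 2)"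
proof -
  have inv: "t ^ n * (inverse (t ^ n) * c) = c" for c
    using assms(1) by (simp flip: mult.assoc)
  have "edotsum \<omega> {..<Suc n} (basept t)
    = L (int n + 1) - inverse (t ^ n) * L (int n) - t ^ n * (L (int n) - inverse (t ^ n) * L (int n - 1))
      - (L (int n) - inverse (t ^ n) * L (int n - 1) - t ^ n * (L (int n - 1) - inverse (t ^ n) * L (int n - 2)))"
    unfolding edotsum_basept[OF le_SucI[OF assms(2)]] basepoly_Suc[OF assms(2)] pconv_mult_linear L_def
    by (simp add: algebra_simps)
  then show ?thesis
    by (simp add: algebra_simps inv)
qed

text \<open>Both sides satisfy the same first-order recursion in \<open>n\<close>. The hypothesis
  \<open>base\<close> is the case of the single variable -1, where \<open>egen\<close> is the square
  of \<open>1 - z\<close> and the sum over signs is \<open>- (1 + s)\<close>.\<close>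

lemma hlsum_eq_edotsum_basept:
  fixes t :: "'a::field_char_0"
  assumes "nonroot t" "n \<ge> 1"
    and base: "\<omega> 1 - 2 * \<omega> 0 + \<omega> (-1) = - (1 + s)"
    and step: "\<And>n. n \<ge> 1 \<Longrightarrow> edotsum \<omega> {..<Suc n} (basept t)
      = - inverse (t ^ n) * (1 + s * t ^ n) * edotsum \<omega> {..<n} (basept t)"
  shows "hlsum t s {..<n} (basept t) = edotsum \<omega> {..<n} (basept t)"
proof -
  have "2 * hlterm t s {..<n} (basept t) = edotsum \<omega> {..<n} (basept t)"
    using assms(2)
  proof (induction n rule: dec_induct)
    case base
    have "hlterm t s {..<1} (basept t) = - (1 + s) / 2"
    proof -
      have "pairs {..<1} = {}"
        by (auto simp: pairs_def)
      then show ?thesis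
        by (simp add: hlterm_def hl_single_def basept_def lessThan_Suc field_simps)
    qed
    moreover have "edotsum \<omega> {..<1} (basept t) = \<omega> 1 - 2 * \<omega> 0 + \<omega> (-1)"
      by (subst edotsum_basept) (simp_all add: basepoly_def pconv_pCons pconv_def)
    ultimately show ?case
      using assms(3) by (simp add: mult.commute)
  next
    case (step n)
    then show ?case
      using assms(4)[OF step(1)] hlterm_basept_Suc[OF assms(1) step(1), of s] by (simp add: mult_ac)
  qed
  then show ?thesis
    using hlsum_basept[OF assms(1,2)] by simp
qed

subsection \<open>The three identities for generic parameters\<close>

text \<open>By the induction hypothesis each coordinate can be changed without changing the
  difference; the path leads from \<open>x\<close> through a generic point \<open>q\<close> to the
  base point, where the difference is 0.\<close>

lemma hlsum_eq_edotsum_lessThan: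
  fixes t :: "'a::field_char_0"
  assumes t: "nonroot t" and \<omega>: "\<omega> 0 = 1"
    and base: "\<And>n. n \<ge> 1 \<Longrightarrow> hlsum t s {..<n} (basept t) = edotsum \<omega> {..<n} (basept t)"
    and x: "hl_regular_strict {..<n} x"
  shows "hldiff t s \<omega> {..<n} x = 0"
  using x
proof (induction n arbitrary: x)
  case 0
  then show ?case
    by (simp add: hldiff_def hlsum_def hlterm_def pairs_def edotsum_def egen_def pconv_1 \<omega>)
next
  case (Suc n)
  let ?I = "{..<Suc n}"
  have IH: "hldiff t s \<omega> (?I - {j}) y = 0" if "j \<in> ?I" "hl_regular_strict (?I - {j}) y" for j y
  proof -
    have "card (?I - {j}) = n"
      using that(1) by simp
    then obtain h where "bij_betw h {..<n} (?I - {j})"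
      using ex_bij_betw_nat_finite[of "?I - {j}"] by (auto simp: lessThan_atLeast0)
    then have h: "inj_on h {..<n}" "h ` {..<n} = ?I - {j}"
      by (auto simp: bij_betw_def)
    have "hl_regular_strict {..<n} (y \<circ> h)"
      using that(2) hl_regular_strict_image[OF h(1), of y] h(2) by simp
    then show ?thesis
      using Suc.IH[of "y \<circ> h"] hldiff_image[OF finite_lessThan h(1), of t s \<omega> y]
      unfolding h(2) by metis
  qed
  define B where "B = x ` ?I \<union> basept t ` ?I"
  have finB: "finite (B \<union> inverse ` B)"
    by (simp add: B_def)
  \<comment> \<open>\<open>q\<close> avoids the values of \<open>x\<close>, those of the base point
    and the inverses of both, so points mixed from \<open>q\<close> and either of them stay regular.
    \<open>x\<close> and the base point themselves may share values.\<close>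
  obtain q where q: "hl_regular_strict ?I q" and B: "\<And>i. q i \<notin> B \<union> inverse ` B"
    using ex_hl_regular_strict_avoiding[OF finB, of ?I] by metis
  have wx: "hl_regular ?I x"
    using Suc.prems by (simp add: hl_regular_strict_def)
  have wb: "hl_regular ?I (basept t)"
    using t by (rule hl_regular_basept)
  have sep: "q i \<noteq> y j \<and> q i * y j \<noteq> 1" if "hl_regular ?I y" "y ` ?I \<subseteq> B" "j \<in> ?I" for y i j
  proof -
    have "y j \<in> B" "y j \<noteq> 0"
      using that by (auto simp: hl_regular_def)
    moreover from this have "q i \<noteq> inverse (y j)"
      using B[of i] by auto
    ultimately show ?thesis
      using B[of i] by (auto simp: field_simps)
  qed
  have "hldiff t s \<omega> ?I (override_on q x ?I) = hldiff t s \<omega> ?I q"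
    by (rule hldiff_override[OF _ IH q wx])
      (use sep[OF wx] Suc.prems in \<open>auto simp: B_def hl_regular_strict_def\<close>)
  moreover have "hldiff t s \<omega> ?I (override_on q x ?I) = hldiff t s \<omega> ?I x"
    by (rule hldiff_cong) simp
  moreover have ne: "basept t i \<noteq> -1" if "i \<noteq> 0" for i
    using t that by (simp add: basept_def nonroot_def)
  have "hldiff t s \<omega> ?I (override_on q (basept t) {1..<Suc n}) = hldiff t s \<omega> ?I q"
    by (rule hldiff_override[OF _ IH q wb]) (use sep[OF wb] ne in \<open>auto simp: B_def\<close>)
  \<comment> \<open>The coordinate 0 comes last: its value -1 ends strictness, and no other
    coordinate has to be changed afterwards.\<close>
  moreover have "hldiff t s \<omega> ?I (override_on q (basept t) (insert 0 {1..<Suc n}))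
      = hldiff t s \<omega> ?I (override_on q (basept t) {1..<Suc n})"
    by (rule hldiff_override_insert[OF _ IH q wb]) (use sep[OF wb] ne in \<open>auto simp: B_def\<close>)
  moreover have "hldiff t s \<omega> ?I (override_on q (basept t) (insert 0 {1..<Suc n})) = hldiff t s \<omega> ?I (basept t)"
    by (rule hldiff_cong) (auto simp: override_on_def)
  moreover have "hldiff t s \<omega> ?I (basept t) = 0"
    using base[of "Suc n"] by (simp add: hldiff_def)
  ultimately show ?case
    by simp
qed

lemma hlsum_eq_edotsum:
  fixes t :: "'a::field_char_0"
  assumes "nonroot t" "\<omega> 0 = 1" "\<omega> 1 - 2 * \<omega> 0 + \<omega> (-1) = - (1 + s)"
    "\<And>n. n \<ge> 1 \<Longrightarrow> edotsum \<omega> {..<Suc n} (basept t)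
      = - inverse (t ^ n) * (1 + s * t ^ n) * edotsum \<omega> {..<n} (basept t)"
    and I: "finite I" and x: "hl_regular_strict I x"
  shows "hlsum t s I x = edotsum \<omega> I x"
proof -
  obtain h where "bij_betw h {..<card I} I"
    using ex_bij_betw_nat_finite[OF I] by (auto simp: lessThan_atLeast0)
  then have h: "inj_on h {..<card I}" "h ` {..<card I} = I"
    by (auto simp: bij_betw_def)
  have "hl_regular_strict {..<card I} (x \<circ> h)"
    using x hl_regular_strict_image[OF h(1), of x] h(2) by simp
  then have "hldiff t s \<omega> {..<card I} (x \<circ> h) = 0"
    using assms(1-4) by (intro hlsum_eq_edotsum_lessThan hlsum_eq_edotsum_basept)
  then have "hldiff t s \<omega> I x = 0"
    using hldiff_image[OF _ h(1), of t s \<omega> x] h(2) by simp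
  then show ?thesis
    by (simp add: hldiff_def)
qed

text \<open>At a multiple \<open>j = \<kappa> * y\<close> this is the assumption on
  \<open>c\<close>; elsewhere both sides are 0.\<close>

lemma stretch_quasiperiodic:
  assumes "\<kappa> > 0" "\<And>y. c (y + 1) = \<rho> * t powi (\<kappa> * y) * c y"
  shows "stretch \<kappa> c (j + \<kappa>) = \<rho> * t powi j * stretch \<kappa> c j"
  using assms by (auto simp: stretch_def div_add_self2)

text \<open>The theta series has \<open>\<kappa> = 3\<close> and
  \<open>\<rho> = - t\<close>.\<close>

lemma hlsum_0_eq_edotsum:
  fixes t :: "'a::field_char_0"
  assumes t: "nonroot t" and I: "finite I" "hl_regular_strict I x"
  defines "\<phi> \<equiv> stretch 3 (\<lambda>y. (-1) powi y * t powi ((3 * y^2 - y) div 2))"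
  shows "hlsum t 0 I x = edotsum (\<lambda>j. \<phi> j + \<phi> (j + 1)) I x"
proof (rule hlsum_eq_edotsum[OF t _ _ _ I])
  have t0: "t \<noteq> 0"
    using t by (simp add: nonroot_def)
  have quasi: "\<phi> (j + 3) = - t * t powi j * \<phi> j" for j
    unfolding \<phi>_def
  proof (rule stretch_quasiperiodic)
    fix y :: int
    have "(3 * (y + 1)^2 - (y + 1)) div 2 = ((3 * y^2 - y) + 2 * (3 * y + 1)) div 2"
      by (simp add: power2_eq_square algebra_simps)
    also have "\<dots> = (3 * y^2 - y) div 2 + (3 * y + 1)"
      by simp
    finally have "t powi ((3 * (y + 1)^2 - (y + 1)) div 2) = t powi ((3 * y^2 - y) div 2) * (t powi (3 * y) * t)"
      using t0 by (simp add: power_int_add)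
    then show "(-1) powi (y + 1) * t powi ((3 * (y + 1)^2 - (y + 1)) div 2)
      = - t * t powi (3 * y) * ((-1) powi y * t powi ((3 * y^2 - y) div 2))"
      by (simp add: power_int_add mult_ac)
  qed simp
  show "\<phi> 0 + \<phi> (0 + 1) = 1" "\<phi> 1 + \<phi> (1 + 1) - 2 * (\<phi> 0 + \<phi> (0 + 1)) + (\<phi> (- 1) + \<phi> (- 1 + 1)) = - (1 + 0)"
    by (simp_all add: \<phi>_def stretch_def)
  fix n :: nat assume n: "n \<ge> 1"
  define L where "L k = pconv \<phi> k (basepoly t n)" for k
  define T V where "T = t ^ n" and "V = inverse T"
  have T: "T * V = 1"
    using t0 by (simp add: T_def V_def)
  have "t powi (int n - 1) * t = T"
    using t0 by (simp add: T_def power_int_diff)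
  \<comment> \<open>With period 3, the relation at \<open>k = n + 2\<close> links exactly the four
    coefficients that occur in the two sums below.\<close>
  moreover have "L (int n + 2) - T * L (int n + 1) = - t * t powi (int n - 1) * (L (int n - 1) - V * L (int n - 2))"
    using pconv_basepoly_shift[where k = "int n + 2" and \<phi> = \<phi>, OF t0 n quasi]
    by (simp add: L_def T_def V_def add.commute)
  moreover have "a2 - (T + V) * a1 + (T + V) * b1 - b2 = - V * (1 + 0 * T) * (a1 - b1)"
    if "p * t = T" "a2 - T * a1 = - t * p * (b1 - V * b2)" for a2 a1 b1 b2 p
  proof -
    have "t * p * (b1 - V * b2) = (p * t) * b1 - (p * t) * V * b2"
      by (simp add: algebra_simps)
    then have "a2 = T * a1 - (T * b1 - b2)"
      using that T by (simp add: algebra_simps)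
    then show ?thesis
      by (simp add: algebra_simps)
  qed
  \<comment> \<open>Since \<open>(1 - z) (1 + 1/z) = 1/z - z\<close>, the coefficient
    \<open>L n\<close> disappears.\<close>
  moreover have "edotsum (\<lambda>j. \<phi> j + \<phi> (j + 1)) {..<n} (basept t) = L (int n + 1) - L (int n - 1)"
    unfolding edotsum_basept[OF n] pconv_plus_shift by (simp add: L_def)
  moreover have "edotsum (\<lambda>j. \<phi> j + \<phi> (j + 1)) {..<Suc n} (basept t)
      = L (int n + 2) - (T + V) * L (int n + 1) + (T + V) * L (int n - 1) - L (int n - 2)"
    unfolding edotsum_basept_Suc[OF t0 n] pconv_plus_shift by (simp add: L_def T_def V_def algebra_simps)
  ultimately show "edotsum (\<lambda>j. \<phi> j + \<phi> (j + 1)) {..<Suc n} (basept t)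
      = - inverse (t ^ n) * (1 + 0 * t ^ n) * edotsum (\<lambda>j. \<phi> j + \<phi> (j + 1)) {..<n} (basept t)"
    unfolding T_def[symmetric] V_def[symmetric] by metis
qed

text \<open>In terms of \<open>u = t^(1/2)\<close> the half-integral exponents become integers. The
  theta series has \<open>\<kappa> = 2\<close> and \<open>\<rho> = u\<close>.\<close>

lemma hlsum_minus_sqrt_eq_edotsum:
  fixes u :: "'a::field_char_0"
  assumes u: "nonroot (u\<^sup>2)" and I: "finite I" "hl_regular_strict I x"
  defines "\<phi> \<equiv> stretch 2 (\<lambda>y. u powi (2 * y^2 - y))"
  shows "hlsum (u\<^sup>2) (- u) I x = edotsum (\<lambda>j. \<phi> j + \<phi> (j + 1)) I x"
proof (rule hlsum_eq_edotsum[OF u _ _ _ I])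
  have u0: "u \<noteq> 0" and t0: "u\<^sup>2 \<noteq> 0"
    using u by (auto simp: nonroot_def)
  have powi: "u\<^sup>2 powi k = u powi (2 * k)" for k
    by (simp add: power_int_mult)
  have quasi: "\<phi> (j + 2) = u * u\<^sup>2 powi j * \<phi> j" for j
    unfolding \<phi>_def
  proof (rule stretch_quasiperiodic)
    fix y :: int
    have "2 * (y + 1)^2 - (y + 1) = 1 + (2 * (2 * y) + (2 * y^2 - y))"
      by (simp add: power2_eq_square algebra_simps)
    moreover have "u powi (1 + (2 * (2 * y) + (2 * y^2 - y)))
        = u powi 1 * (u powi (2 * (2 * y)) * u powi (2 * y^2 - y))"
      using u0 by (simp only: power_int_add simp_thms)
    ultimately show "u powi (2 * (y + 1)^2 - (y + 1)) = u * u\<^sup>2 powi (2 * y) * u powi (2 * y^2 - y)"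
      by (simp only: powi power_int_1_right mult.assoc)
  qed simp
  show "\<phi> 0 + \<phi> (0 + 1) = 1" "\<phi> 1 + \<phi> (1 + 1) - 2 * (\<phi> 0 + \<phi> (0 + 1)) + (\<phi> (- 1) + \<phi> (- 1 + 1)) = - (1 + - u)"
    by (simp_all add: \<phi>_def stretch_def)
  fix n :: nat assume n: "n \<ge> 1"
  define L where "L k = pconv \<phi> k (basepoly (u\<^sup>2) n)" for k
  define T V where "T = (u\<^sup>2) ^ n" and "V = inverse T"
  have T: "T * V = 1"
    using t0 by (simp add: T_def V_def)
  have p1: "u\<^sup>2 powi int n = T" "u\<^sup>2 powi (int n - 1) * u\<^sup>2 = T"
    using t0 by (simp_all add: T_def power_int_diff)
  \<comment> \<open>With period 2, the relations at \<open>k = n + 2\<close> and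
    \<open>k = n + 1\<close> both involve \<open>L n\<close>, which is absent from the claim; the
    two together eliminate it.\<close>
  have e1: "L (int n + 2) - T * L (int n + 1) = u * T * (L (int n) - V * L (int n - 1))"
    using pconv_basepoly_shift[where k = "int n + 2" and \<phi> = \<phi>, OF t0 n quasi] p1(1)
    by (simp add: L_def T_def V_def add.commute)
  have "L (int n + 1) - T * L (int n) = u * u\<^sup>2 powi (int n - 1) * (L (int n - 1) - V * L (int n - 2))"
    using pconv_basepoly_shift[where k = "int n + 1" and \<phi> = \<phi>, OF t0 n quasi]
    by (simp add: L_def T_def V_def add.commute)
  then have "u * (L (int n + 1) - T * L (int n)) = (u\<^sup>2 powi (int n - 1) * u\<^sup>2) * (L (int n - 1) - V * L (int n - 2))"
    by (simp add: power2_eq_square)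
  then have e2: "u * (L (int n + 1) - T * L (int n)) = T * (L (int n - 1) - V * L (int n - 2))"
    unfolding p1(2) .
  have e3: "edotsum (\<lambda>j. \<phi> j + \<phi> (j + 1)) {..<n} (basept (u\<^sup>2)) = L (int n + 1) - L (int n - 1)"
    unfolding edotsum_basept[OF n] pconv_plus_shift by (simp add: L_def)
  have e4: "edotsum (\<lambda>j. \<phi> j + \<phi> (j + 1)) {..<Suc n} (basept (u\<^sup>2))
      = L (int n + 2) - (T + V) * L (int n + 1) + (T + V) * L (int n - 1) - L (int n - 2)"
    unfolding edotsum_basept_Suc[OF t0 n] pconv_plus_shift by (simp add: L_def T_def V_def algebra_simps)
  have alg: "a2 - (T + V) * a1 + (T + V) * b1 - b2 = - V * (1 + - u * T) * (a1 - b1)"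
    if "a2 - T * a1 = u * T * (a0 - V * b1)" "u * (a1 - T * a0) = T * (b1 - V * b2)" for a2 a1 a0 b1 b2
    using that T by algebra
  show "edotsum (\<lambda>j. \<phi> j + \<phi> (j + 1)) {..<Suc n} (basept (u\<^sup>2))
      = - inverse ((u\<^sup>2) ^ n) * (1 + - u * (u\<^sup>2) ^ n) * edotsum (\<lambda>j. \<phi> j + \<phi> (j + 1)) {..<n} (basept (u\<^sup>2))"
    unfolding T_def[symmetric] V_def[symmetric] e3 e4 by (rule alg[OF e1 e2])
qed

text \<open>Here the theta series, with \<open>\<kappa> = 2\<close> and \<open>\<rho> = - t\<close>,
  enters without the factor \<open>1 + 1/z\<close>, and the single relation at
  \<open>k = n + 1\<close> suffices.\<close>

lemma hlsum_1_eq_edotsum: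
  fixes t :: "'a::field_char_0"
  assumes t: "nonroot t" and I: "finite I" "hl_regular_strict I x"
  defines "\<phi> \<equiv> stretch 2 (\<lambda>y. (-1) powi y * t powi (y^2))"
  shows "hlsum t 1 I x = edotsum \<phi> I x"
proof (rule hlsum_eq_edotsum[OF t _ _ _ I])
  have t0: "t \<noteq> 0"
    using t by (simp add: nonroot_def)
  have quasi: "\<phi> (j + 2) = - t * t powi j * \<phi> j" for j
    unfolding \<phi>_def
  proof (rule stretch_quasiperiodic)
    fix y :: int
    have "(y + 1)^2 = y^2 + (2 * y + 1)"
      by (simp add: power2_eq_square algebra_simps)
    then have "t powi ((y + 1)^2) = t powi (y^2) * (t powi (2 * y) * t)"
      using t0 by (simp add: power_int_add)
    then show "(-1) powi (y + 1) * t powi ((y + 1)^2) = - t * t powi (2 * y) * ((-1) powi y * t powi (y^2))"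
      by (simp add: power_int_add mult_ac)
  qed simp
  show "\<phi> 0 = 1" "\<phi> 1 - 2 * \<phi> 0 + \<phi> (- 1) = - (1 + 1)"
    by (simp_all add: \<phi>_def stretch_def)
  fix n :: nat assume n: "n \<ge> 1"
  define L where "L k = pconv \<phi> k (basepoly t n)" for k
  define T V where "T = t ^ n" and "V = inverse T"
  have T: "T * V = 1"
    using t0 by (simp add: T_def V_def)
  have "t powi (int n - 1) * t = T"
    using t0 by (simp add: T_def power_int_diff)
  moreover have "L (int n + 1) - T * L (int n) = - t * t powi (int n - 1) * (L (int n - 1) - V * L (int n - 2))"
    using pconv_basepoly_shift[where k = "int n + 1" and \<phi> = \<phi>, OF t0 n quasi]
    by (simp add: L_def T_def V_def add.commute)
  moreover have "a1 - (1 + T + V) * a0 + (1 + T + V) * b1 - b2 = - V * (1 + 1 * T) * (a0 - b1)"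
    if "p * t = T" "a1 - T * a0 = - t * p * (b1 - V * b2)" for a1 a0 b1 b2 p
  proof -
    have "t * p * (b1 - V * b2) = (p * t) * b1 - (p * t) * V * b2"
      by (simp add: algebra_simps)
    then have "a1 = T * a0 - (T * b1 - b2)"
      using that T by (simp add: algebra_simps)
    then have "a1 - (1 + T + V) * a0 + (1 + T + V) * b1 - b2 = - V * (a0 - b1) - (a0 - b1)"
      by (simp add: algebra_simps)
    also have "\<dots> = - V * (a0 - b1) - (V * T) * (a0 - b1)"
      using T by (simp add: mult.commute)
    finally show ?thesis
      by (simp add: algebra_simps)
  qed
  moreover have "edotsum \<phi> {..<n} (basept t) = L (int n) - L (int n - 1)"
    unfolding edotsum_basept[OF n] by (simp add: L_def)
  moreover have "edotsum \<phi> {..<Suc n} (basept t)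
    = L (int n + 1) - (1 + T + V) * L (int n) + (1 + T + V) * L (int n - 1) - L (int n - 2)"
    unfolding edotsum_basept_Suc[OF t0 n] by (simp add: L_def T_def V_def)
  ultimately show "edotsum \<phi> {..<Suc n} (basept t)
      = - inverse (t ^ n) * (1 + 1 * t ^ n) * edotsum \<phi> {..<n} (basept t)"
    unfolding T_def[symmetric] V_def[symmetric] by metis
qed

subsection \<open>Extension to all parameters\<close>

definition polyfun :: "('a::field \<Rightarrow> 'a) \<Rightarrow> bool" where
  "polyfun f \<longleftrightarrow> (\<exists>p. \<forall>t. f t = poly p t)"

lemma polyfun_const [intro]: "polyfun (\<lambda>_. c)"
  unfolding polyfun_def by (rule exI[of _ "[:c:]"]) simp

lemma polyfun_id [intro]: "polyfun (\<lambda>t. t)"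
  unfolding polyfun_def by (rule exI[of _ "[:0, 1:]"]) simp

lemma polyfun_add [intro]: "polyfun f \<Longrightarrow> polyfun g \<Longrightarrow> polyfun (\<lambda>t. f t + g t)"
  unfolding polyfun_def by (metis poly_add)

lemma polyfun_mult [intro]: "polyfun f \<Longrightarrow> polyfun g \<Longrightarrow> polyfun (\<lambda>t. f t * g t)"
  unfolding polyfun_def by (metis poly_mult)

lemma polyfun_diff [intro]: "polyfun f \<Longrightarrow> polyfun g \<Longrightarrow> polyfun (\<lambda>t. f t - g t)"
  unfolding polyfun_def by (metis poly_diff)

lemma polyfun_minus [intro]: "polyfun f \<Longrightarrow> polyfun (\<lambda>t. - f t)"
  unfolding polyfun_def by (metis poly_minus)

lemma polyfun_divide [intro]: "polyfun f \<Longrightarrow> polyfun (\<lambda>t. f t / c)"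
  unfolding divide_inverse by (intro polyfun_mult polyfun_const)

lemma polyfun_power [intro]: "polyfun f \<Longrightarrow> polyfun (\<lambda>t. f t ^ k)"
  unfolding polyfun_def by (metis poly_power)

lemma polyfun_power_int: "polyfun f \<Longrightarrow> k \<ge> 0 \<Longrightarrow> polyfun (\<lambda>t. f t powi k)"
  unfolding power_int_def by auto

lemma polyfun_sum [intro]: "(\<And>i. i \<in> A \<Longrightarrow> polyfun (f i)) \<Longrightarrow> polyfun (\<lambda>t. \<Sum>i\<in>A. f i t)"
  by (induction A rule: infinite_finite_induct) auto

lemma polyfun_prod [intro]: "(\<And>i. i \<in> A \<Longrightarrow> polyfun (f i)) \<Longrightarrow> polyfun (\<lambda>t. \<Prod>i\<in>A. f i t)"
  by (induction A rule: infinite_finite_induct) auto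

lemmas polyfun_intros = polyfun_const polyfun_id polyfun_add polyfun_mult polyfun_diff polyfun_minus
  polyfun_divide polyfun_power polyfun_sum polyfun_prod

text \<open>In characteristic 0 the integers from 2 on are infinitely many points, and by
  \<open>nonroot_of_nat\<close> they are parameters for which the identities are already
  available.\<close>

lemma polyfun_eqI:
  fixes f g :: "'a::field_char_0 \<Rightarrow> 'a"
  assumes "polyfun f" "polyfun g" "\<And>m. m \<ge> 2 \<Longrightarrow> f (of_nat m) = g (of_nat m)"
  shows "f t = g t"
proof -
  obtain p q where p: "\<And>t. f t = poly p t" and q: "\<And>t. g t = poly q t"
    using assms(1,2) by (auto simp: polyfun_def)
  let ?A = "of_nat ` {2..<degree p + degree q + 3} :: 'a set"
  have "card ?A = degree p + degree q + 1"
    by (subst card_image) (auto simp: inj_on_def)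
  then have "p = q"
    using assms(3) by (intro poly_eqI_degree[of ?A]) (auto simp flip: p q)
  then show ?thesis
    by (simp add: p q)
qed

text \<open>The parameters occur in numerators only; the denominators of \<open>hl_single\<close>
  and \<open>hl_pair\<close> depend on the variables alone.\<close>

lemma polyfun_hlsum:
  assumes "polyfun f" "polyfun g"
  shows "polyfun (\<lambda>u. hlsum (f u) (g u) I x)"
proof -
  have "polyfun (\<lambda>u. case k of (i, j) \<Rightarrow> hl_pair (f u) (y i * y j))" for k and y :: "nat \<Rightarrow> 'a"
    unfolding hl_pair_def by (cases k) (simp, intro polyfun_intros assms)
  then show ?thesis
    unfolding hlsum_def hlterm_def hl_single_def by (intro polyfun_intros assms)
qed

lemma polyfun_edotsum:
  assumes "\<And>j. polyfun (\<lambda>u. \<omega> u j)"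
  shows "polyfun (\<lambda>u. edotsum (\<omega> u) I x)"
  unfolding edotsum_def pconv_def by (intro polyfun_intros assms)

lemma polyfun_stretch:
  assumes "\<And>y. polyfun (\<lambda>u. c u y)"
  shows "polyfun (\<lambda>u. stretch \<kappa> (c u) j)"
  using assms unfolding stretch_def by (cases "\<kappa> dvd j") auto

lemma nonroot_of_nat:
  assumes "m \<ge> 2"
  shows "nonroot (of_nat m :: 'a::field_char_0)"
proof -
  have "m ^ k \<noteq> 1" if "k \<ge> 1" for k
    using assms that by simp
  then have "(of_nat m :: 'a) ^ k \<noteq> 1" if "k \<ge> 1" for k
    using that by (metis of_nat_power of_nat_eq_1_iff)
  then show ?thesis
    using assms by (simp add: nonroot_def)
qed

section \<open>Reduction of the Hall-Littlewood polynomial to the sum over signs\<close>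

lemma hl_regular_strict_if_hl_generic:
  assumes "hl_generic n x t"
  shows "hl_regular_strict {1..n} x"
  using assms unfolding hl_generic_def hl_regular_strict_def hl_regular_def by (auto simp: power2_eq_1_iff)

text \<open>The one-variable factors and the factors \<open>hl_pair\<close> are symmetric in the
  variables as a whole, so a permutation affects only the quotients of differences.\<close>

lemma hl_summand_permuted:
  fixes y :: "nat \<Rightarrow> 'a::field"
  assumes "\<sigma> permutes {1..n}" "\<And>i. i \<in> {1..n} \<Longrightarrow> y i \<noteq> 0 \<and> y i \<noteq> 1 \<and> y i \<noteq> -1"
  shows "hl_summand n (replicate n 1) t s (-1) (\<lambda>i. y (\<sigma> i)) = hlterm t s {1..n} y *
    (\<Prod>(i, j)\<in>pairs {1..n}. (t * y (\<sigma> i) - y (\<sigma> j)) / (y (\<sigma> i) - y (\<sigma> j)))"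
proof -
  have "(\<Prod>i=1..n. y (\<sigma> i) powi (- int (part (replicate n 1) i))
      * ((1 - s * y (\<sigma> i)) * (1 - (-1) * y (\<sigma> i)) / (1 - (y (\<sigma> i))^2)))
    = (\<Prod>i=1..n. hl_single s (y (\<sigma> i)))"
  proof (rule prod.cong[OF refl])
    fix i assume i: "i \<in> {1..n}"
    have "\<sigma> i \<in> {1..n}"
      using i permutes_in_image[OF assms(1)] by blast
    then have y: "y (\<sigma> i) \<noteq> 0" "y (\<sigma> i) \<noteq> 1" "1 + y (\<sigma> i) \<noteq> 0"
      using assms(2)[of "\<sigma> i"] by (auto simp: add_eq_0_iff)
    have "1 - (y (\<sigma> i))^2 = (1 - y (\<sigma> i)) * (1 + y (\<sigma> i))"
      by (simp add: power2_eq_square algebra_simps)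
    then have "(1 - s * y (\<sigma> i)) * (1 - (-1) * y (\<sigma> i)) / (1 - (y (\<sigma> i))^2)
        = (1 - s * y (\<sigma> i)) / (1 - y (\<sigma> i))"
      using y(3) by simp
    moreover have "part (replicate n 1) i = 1"
      using i by (auto simp: part_def)
    ultimately show "y (\<sigma> i) powi (- int (part (replicate n 1) i))
      * ((1 - s * y (\<sigma> i)) * (1 - (-1) * y (\<sigma> i)) / (1 - (y (\<sigma> i))^2)) = hl_single s (y (\<sigma> i))"
      by (simp add: hl_single_def power_int_minus divide_inverse mult_ac)
  qed
  also have "\<dots> = (\<Prod>i=1..n. hl_single s (y i))"
    using prod.permute[OF assms(1), of "\<lambda>i. hl_single s (y i)"] by (simp add: comp_def)
  finally have 1: "(\<Prod>i=1..n. y (\<sigma> i) powi (- int (part (replicate n 1) i))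
      * ((1 - s * y (\<sigma> i)) * (1 - (-1) * y (\<sigma> i)) / (1 - (y (\<sigma> i))^2))) = \<dots>" .
  have 2: "{(i, j). 1 \<le> i \<and> i < j \<and> j \<le> n} = pairs {1..n}"
    by (auto simp: pairs_def)
  have "(\<Prod>(i, j)\<in>pairs {1..n}. hl_pair t (y (\<sigma> i) * y (\<sigma> j))) = (\<Prod>(i, j)\<in>pairs {1..n}. hl_pair t (y i * y j))"
    using prod_pairs_image[OF finite_atLeastAtMost[of 1 n] permutes_inj_on[OF assms(1)], of "\<lambda>i j. hl_pair t (y i * y j)"]
    unfolding permutes_image[OF assms(1)] by (simp add: mult.commute)
  moreover have "(\<Prod>(i, j)\<in>pairs {1..n}. (t * y (\<sigma> i) - y (\<sigma> j)) * (1 - t * y (\<sigma> i) * y (\<sigma> j))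
        / ((y (\<sigma> i) - y (\<sigma> j)) * (1 - y (\<sigma> i) * y (\<sigma> j))))
    = (\<Prod>(i, j)\<in>pairs {1..n}. hl_pair t (y (\<sigma> i) * y (\<sigma> j)))
      * (\<Prod>(i, j)\<in>pairs {1..n}. (t * y (\<sigma> i) - y (\<sigma> j)) / (y (\<sigma> i) - y (\<sigma> j)))"
    unfolding prod.distrib[symmetric]
    by (rule prod.cong) (auto simp: hl_pair_def mult_ac)
  ultimately show ?thesis
    unfolding hl_summand_def 1 2 hlterm_def by simp
qed

text \<open>For each sign choice the sum over permutations yields the same factor \<open>?v\<close>,
  which is \<open>hl_v\<close>; the factor \<open>qpoch (s1 * s2)\<close> is empty because the
  partition has \<open>n\<close> parts.\<close>

lemma hl_B_ones_eq_hlsum: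
  fixes x :: "nat \<Rightarrow> 'a::field"
  assumes "n \<ge> 1" "hl_generic n x t"
  shows "hl_B n (replicate n 1) x t s = hlsum t s {1..n} x"
proof -
  let ?v = "qpoch t t n / (1 - t) ^ n"
  have t: "t ^ k \<noteq> 1" if "k \<in> {1..n}" for k
    using assms(2) that by (auto simp: hl_generic_def)
  then have t1: "t \<noteq> 1"
    using t[of 1] assms(1) by auto
  have "1 - t * t ^ i \<noteq> 0" if "i < n" for i
    using t[of "Suc i"] that by simp
  then have v: "?v \<noteq> 0"
    using t1 by (simp add: qpoch_def)
  have gen: "x i \<noteq> 0" "x i \<noteq> 1" "x i \<noteq> -1" if "i \<in> {1..n}" for i
    using hl_regular_strict_if_hl_generic[OF assms(2)] that by (auto simp: hl_regular_strict_def hl_regular_def)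
  have sep: "x i \<noteq> x j" "x i * x j \<noteq> 1" if "i \<in> {1..n}" "j \<in> {1..n}" "i \<noteq> j" for i j
    using hl_regular_strict_if_hl_generic[OF assms(2)] that by (auto simp: hl_regular_strict_def hl_regular_def)
  have "(\<Sum>\<sigma> | \<sigma> permutes {1..n}. hl_summand n (replicate n 1) t s (-1) (\<lambda>i. flip E x (\<sigma> i)))
    = hlterm t s {1..n} (flip E x) * ?v" for E
  proof -
    have nz: "flip E x i \<noteq> 0 \<and> flip E x i \<noteq> 1 \<and> flip E x i \<noteq> -1" if "i \<in> {1..n}" for i
      using gen[OF that] by (auto simp: flip_def inverse_eq_iff_eq[of _ "-1", simplified])
    have "inj_on (flip E x) {1..n}"
    proof (rule inj_onI)
      fix i j assume ij: "i \<in> {1..n}" "j \<in> {1..n}" "flip E x i = flip E x j"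
      show "i = j"
      proof (rule ccontr)
        assume "i \<noteq> j"
        then have "x i \<noteq> x j" "x i * x j \<noteq> 1"
          using sep ij by auto
        then show False
          using ij(3) gen[OF ij(1)] gen[OF ij(2)] by (auto simp: flip_def field_simps split: if_splits)
      qed
    qed
    then have "(\<Sum>\<sigma> | \<sigma> permutes {1..n}. \<Prod>(i, j)\<in>pairs {1..n}.
      (t * flip E x (\<sigma> i) - flip E x (\<sigma> j)) / (flip E x (\<sigma> i) - flip E x (\<sigma> j))) = ?v"
      using nz t1 by (intro sum_permutations_prod_quotient) auto
    moreover have "(\<Sum>\<sigma> | \<sigma> permutes {1..n}. hl_summand n (replicate n 1) t s (-1) (\<lambda>i. flip E x (\<sigma> i)))
      = (\<Sum>\<sigma> | \<sigma> permutes {1..n}. hlterm t s {1..n} (flip E x) * (\<Prod>(i, j)\<in>pairs {1..n}.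
      (t * flip E x (\<sigma> i) - flip E x (\<sigma> j)) / (flip E x (\<sigma> i) - flip E x (\<sigma> j))))"
      using nz by (intro sum.cong[OF refl] hl_summand_permuted) auto
    ultimately show ?thesis
      by (simp only: sum_distrib_left[symmetric])
  qed
  then have "(\<Sum>E\<in>Pow {1..n}. \<Sum>\<sigma> | \<sigma> permutes {1..n}.
      hl_summand n (replicate n 1) t s (-1) (\<lambda>i. flip E x (\<sigma> i))) = hlsum t s {1..n} x * ?v"
    unfolding hlsum_def sum_distrib_right by simp
  \<comment> \<open>Membership in the set of inverted indices is tested at
    \<open>\<sigma> i\<close>, so the action evaluates at \<open>flip E x\<close> after \<sigma>,
    and signs and permutations can be summed separately.\<close>
  moreover have "(\<Sum>w\<in>hyperoct n. hyperoct_act w (hl_summand n (replicate n 1) t s (-1)) x)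
    = (\<Sum>E\<in>Pow {1..n}. \<Sum>\<sigma> | \<sigma> permutes {1..n}.
      hl_summand n (replicate n 1) t s (-1) (\<lambda>i. flip E x (\<sigma> i)))"
    unfolding hyperoct_def
    by (subst sum.swap) (simp add: sum.cartesian_product hyperoct_act_def flip_def case_prod_unfold)
  moreover have "count_list (replicate n (1 :: nat)) 1 = n"
    by (induction n) auto
  then have "hl_v n (replicate n 1) t = ?v"
    using assms(1) by (simp add: hl_v_def qpoch_def)
  ultimately show ?thesis
    using v by (simp add: hl_B_def hl_BC_def qpoch_def)
qed

section \<open>The right-hand sides as constant terms, and the final comparison\<close>

lemma Sum_any_edot_stretch:
  fixes x :: "nat \<Rightarrow> 'a::field"
  assumes "\<kappa> > 0"
  shows "(\<Sum>y. c y * edot n x (int n - \<kappa> * y)) = edotsum (stretch \<kappa> c) {1..n} x"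
  unfolding Sum_any_edot(2)[OF assms] edotsum_def by simp

lemma Sum_any_edot_plus_stretch:
  fixes x :: "nat \<Rightarrow> 'a::field"
  assumes "\<kappa> > 0"
  shows "(\<Sum>y. c y * (edot n x (int n - \<kappa> * y) + edot n x (int n + 1 - \<kappa> * y)))
    = edotsum (\<lambda>j. stretch \<kappa> c j + stretch \<kappa> c (j + 1)) {1..n} x"
  unfolding distrib_left Sum_any.distrib[OF Sum_any_edot(1)[OF assms] Sum_any_edot(1)[OF assms]]
    Sum_any_edot(2)[OF assms] edotsum_def pconv_plus_shift by simp

text \<open>Only nonnegative powers of the parameter occur, so every coefficient is a polynomial in
  it. Both bounds come from \<open>y \<le> y^2\<close>.\<close>

lemma pentagonal_ge_0: "(3 * y^2 - y) div 2 \<ge> (0 :: int)" and hexagonal_ge_0: "2 * y^2 - y \<ge> (0 :: int)"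
proof -
  have "y \<le> y^2"
    by (cases "y \<ge> 1") (auto simp: power2_eq_square intro: order.trans[of _ 0])
  moreover have "0 \<le> y^2" by simp
  ultimately show "(3 * y^2 - y) div 2 \<ge> 0" "2 * y^2 - y \<ge> 0"
    by linarith+
qed

theorem lemma4p1:
  fixes n :: nat and x :: "nat \<Rightarrow> 'a::field_char_0" and t :: 'a
  assumes "n \<ge> 1"
    and "hl_generic n x t"
  shows
    "hl_B n (replicate n 1) x t 0 =
       (\<Sum>y::int. (-1) powi y * t powi ((3 * y^2 - y) div 2)
          * (edot n x (int n - 3 * y) + edot n x (int n + 1 - 3 * y)))
     \<and> (\<forall>u. u^2 = t \<longrightarrow>
          hl_B n (replicate n 1) x t (- u) =
            (\<Sum>y::int. u powi (2 * y^2 - y)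
               * (edot n x (int n - 2 * y) + edot n x (int n + 1 - 2 * y))))
     \<and> hl_B n (replicate n 1) x t 1 =
          1 / 2 * (\<Sum>y::int. (-1) powi y * t powi (y^2)
            * (edot n x (int n - 2 * y) + edot n x (int n - 2 * y)))
     \<and> 1 / 2 * (\<Sum>y::int. (-1) powi y * t powi (y^2)
            * (edot n x (int n - 2 * y) + edot n x (int n - 2 * y))) =
          (\<Sum>y::int. (-1) powi y * t powi (y^2) * edot n x (int n - 2 * y))"
proof (intro conjI allI impI)
  have B: "hl_B n (replicate n 1) x t s = hlsum t s {1..n} x" for s
    using assms by (rule hl_B_ones_eq_hlsum)
  have gen: "hl_regular_strict {1..n} x"
    using assms(2) by (rule hl_regular_strict_if_hl_generic)
  \<comment> \<open>With \<open>x\<close> fixed both sides are polynomials in the parameter, and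
    \<open>gen\<close> does not involve it. Agreement at the integers from 2 on thus covers the
    given \<open>t\<close>, which may be 0 or a root of unity of order above
    \<open>n\<close>.\<close>
  have "hlsum t 0 {1..n} x = edotsum (\<lambda>j. stretch 3 (\<lambda>y. (-1) powi y * t powi ((3 * y^2 - y) div 2)) j
      + stretch 3 (\<lambda>y. (-1) powi y * t powi ((3 * y^2 - y) div 2)) (j + 1)) {1..n} x"
    by (rule polyfun_eqI[where f = "\<lambda>t. hlsum t 0 {1..n} x"])
      (assumption | intro polyfun_hlsum polyfun_edotsum polyfun_stretch polyfun_power_int pentagonal_ge_0
        polyfun_intros hlsum_0_eq_edotsum nonroot_of_nat gen finite_atLeastAtMost)+
  then show "hl_B n (replicate n 1) x t 0 =
       (\<Sum>y::int. (-1) powi y * t powi ((3 * y^2 - y) div 2)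
          * (edot n x (int n - 3 * y) + edot n x (int n + 1 - 3 * y)))"
    unfolding B by (subst Sum_any_edot_plus_stretch) simp_all
  show "hl_B n (replicate n 1) x t (- u) = (\<Sum>y::int. u powi (2 * y^2 - y)
      * (edot n x (int n - 2 * y) + edot n x (int n + 1 - 2 * y)))" if "u^2 = t" for u
  proof -
    \<comment> \<open>The polynomial variable is now \<open>u\<close>; at \<open>u = m\<close> the
      parameter is \<open>m^2\<close>, again an integer from 2 on.\<close>
    have sq: "nonroot ((of_nat m)\<^sup>2 :: 'a)" if "m \<ge> 2" for m
    proof -
      have "2 \<le> m\<^sup>2"
        using that power_mono[OF that, of 2] by simp
      then show ?thesis
        using nonroot_of_nat[of "m\<^sup>2"] by simp
    qed
    have "hlsum (u\<^sup>2) (- u) {1..n} x = edotsum (\<lambda>j. stretch 2 (\<lambda>y. u powi (2 * y^2 - y)) j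
      + stretch 2 (\<lambda>y. u powi (2 * y^2 - y)) (j + 1)) {1..n} x"
      by (rule polyfun_eqI[where f = "\<lambda>u. hlsum (u\<^sup>2) (- u) {1..n} x"])
        (assumption | intro polyfun_hlsum polyfun_edotsum polyfun_stretch polyfun_power_int hexagonal_ge_0
          polyfun_intros hlsum_minus_sqrt_eq_edotsum sq gen finite_atLeastAtMost)+
    then show ?thesis
      unfolding B that by (subst Sum_any_edot_plus_stretch) simp_all
  qed
  have "hlsum t 1 {1..n} x = edotsum (stretch 2 (\<lambda>y. (-1) powi y * t powi (y^2))) {1..n} x"
    by (rule polyfun_eqI[where f = "\<lambda>t. hlsum t 1 {1..n} x"])
      (assumption | intro polyfun_hlsum polyfun_edotsum polyfun_stretch polyfun_power_int zero_le_power2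
        polyfun_intros hlsum_1_eq_edotsum nonroot_of_nat gen finite_atLeastAtMost)+
  then have 3: "hl_B n (replicate n 1) x t 1 = (\<Sum>y::int. (-1) powi y * t powi (y^2) * edot n x (int n - 2 * y))"
    unfolding B by (subst Sum_any_edot_stretch) simp_all
  have "(\<Sum>y::int. (-1) powi y * t powi (y^2) * (edot n x (int n - 2 * y) + edot n x (int n - 2 * y)))
    = (\<Sum>y::int. (-1) powi y * t powi (y^2) * edot n x (int n - 2 * y))
      + (\<Sum>y::int. (-1) powi y * t powi (y^2) * edot n x (int n - 2 * y))"
    unfolding distrib_left by (intro Sum_any.distrib Sum_any_edot(1)) simp_all
  then show 4: "1 / 2 * (\<Sum>y::int. (-1) powi y * t powi (y^2)
            * (edot n x (int n - 2 * y) + edot n x (int n - 2 * y))) =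
          (\<Sum>y::int. (-1) powi y * t powi (y^2) * edot n x (int n - 2 * y))"
    by simp
  show "hl_B n (replicate n 1) x t 1 =
          1 / 2 * (\<Sum>y::int. (-1) powi y * t powi (y^2)
            * (edot n x (int n - 2 * y) + edot n x (int n - 2 * y)))"
    unfolding 3 4 ..
qed

end
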